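(* Suppose $p>0$ and $\alpha$ is real. Then the following conditions are equivalent for holomorphic functions $f$ in $\mathbb B_n$. (a) $f\in A^p_\alpha$. (b) For some nonnegative integer $k$ with $kp+\alpha>-1$ the functions $(1-|z|^2)^{|m|}\partial^mf(z)$, where $|m|=k$, all belong to $L^p(\mathbb B_n,dv_\alpha)$. (c) For every nonnegative integer $k$ with $kp+\alpha>-1$ the functions $(1-|z|^2)^{|m|}\partial^mf(z)$, where $|m|=k$, all belong to $L^p(\mathbb B_n,dv_\alpha)$.
   Context: Fix a positive integer $n$. $\mathbb B_n$ is the open unit ball of $\mathbb C^n$, $dv$ is volume measure, and $dv_\alpha(z)=(1-|z|^2)^\alpha dv(z)$ for real $\alpha$ (normalized to be a probability measure when $\alpha>-1$). For a multi-index $m=(m_1,\dots,m_n)$ of nonnegative integers, $|m|=m_1+\cdots+m_n$ and $\partial^mf=\frac{\partial^{|m|}f}{\partial z_1^{m_1}\cdots\partial z_n^{m_n}}$. The radial derivative is $Rf(z)=\sum_{k=1}^n z_k\frac{\partial f}{\partial z_k}(z)$, $R^k$ is its $k$-fold iterate, $R^0f=f$. For $p>0$ and real $\alpha$, $A^p_\alpha$ is the space of holomorphic $f$ in $\mathbb B_n$ such that, for a nonnegative integer $k$ with $pk+\alpha>-1$, $(1-|z|^2)^kR^kf(z)\in L^p(\mathbb B_n,dv_\alpha)$ (independent of the choice of such $k$). *)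

theory Defs
  imports "HOL-Analysis.Analysis"
begin

(* Complex differentiability: the Frechet derivative is C-linear (additivity and
   boundedness are part of has_derivative). *)
definition holomorphic_vec_on :: "(complex ^ 'n \<Rightarrow> complex) \<Rightarrow> (complex ^ 'n) set \<Rightarrow> bool" where
  "holomorphic_vec_on f S \<longleftrightarrow>
     (\<forall>z\<in>S. \<exists>D. (f has_derivative D) (at z within S) \<and> (\<forall>c v. D (c *s v) = c * D v))"

definition partial_deriv :: "'n \<Rightarrow> (complex ^ 'n \<Rightarrow> complex) \<Rightarrow> complex ^ 'n \<Rightarrow> complex" where
  "partial_deriv k f z = deriv (\<lambda>w. f (z + axis k w)) 0"

definition multi_abs :: "('n::finite \<Rightarrow> nat) \<Rightarrow> nat" where
  "multi_abs m = (\<Sum>k\<in>UNIV. m k)"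

(* The linear order on the index type plays the role of 1 < ... < n; with indices listed
   increasingly this is (d/dz_1)^m_1 ( ... ((d/dz_n)^m_n f)), the last variable first. *)
definition multi_deriv ::
    "('n::{finite,linorder} \<Rightarrow> nat) \<Rightarrow> (complex ^ 'n::{finite,linorder} \<Rightarrow> complex)
       \<Rightarrow> complex ^ 'n::{finite,linorder} \<Rightarrow> complex" where
  "multi_deriv m f = foldr (\<lambda>k. partial_deriv k ^^ m k) (sorted_list_of_set UNIV) f"

definition radial_deriv :: "(complex ^ 'n \<Rightarrow> complex) \<Rightarrow> complex ^ 'n \<Rightarrow> complex" where
  "radial_deriv f z = (\<Sum>k\<in>UNIV. z $ k * partial_deriv k f z)"

(* For \<alpha> \<le> -1 the weight is not integrable over the ball, so there is no normalization. *)
definition weight_const :: "'n::finite itself \<Rightarrow> real \<Rightarrow> real" where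
  "weight_const _ \<alpha> =
     (if \<alpha> > -1 then 1 / (LINT z:ball (0 :: complex ^ 'n) 1|lborel. (1 - (norm z)\<^sup>2) powr \<alpha>) else 1)"

definition weighted_volume :: "real \<Rightarrow> (complex ^ 'n) measure" where
  "weighted_volume \<alpha> =
     density (restrict_space lborel (ball 0 1))
       (\<lambda>z. ennreal (weight_const TYPE('n) \<alpha> * (1 - (norm z)\<^sup>2) powr \<alpha>))"

(* All p > 0 are allowed, also p < 1, where this is not a normed space. *)
definition Lp :: "real \<Rightarrow> 'a measure \<Rightarrow> ('a \<Rightarrow> complex) set" where
  "Lp p M = {g \<in> borel_measurable M. integrable M (\<lambda>z. norm (g z) powr p)}"

definition bergman_space :: "real \<Rightarrow> real \<Rightarrow> (complex ^ 'n \<Rightarrow> complex) set" where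
  "bergman_space p \<alpha> =
     {f. holomorphic_vec_on f (ball 0 1) \<and>
         (\<exists>k::nat. p * real k + \<alpha> > -1 \<and>
            (\<lambda>z. of_real ((1 - (norm z)\<^sup>2) ^ k) * (radial_deriv ^^ k) f z)
              \<in> Lp p (weighted_volume \<alpha>))}"

end

theory Submission
  imports Defs "HOL-Complex_Analysis.Complex_Analysis"
begin

text \<open>Write $\delta(z) = 1 - |z|$, which is comparable with $1 - |z|^2$ on the ball, and let $A_\beta$ be
the class of holomorphic $F$ for which $|F|^p \delta^\beta$ is integrable over the ball
(\<open>weighted_class\<close>).  Condition (a) says that $R^k f$ lies in $A_{\alpha + pk}$ for some admissible
$k$, while (b) and (c) say that all derivatives $\partial^m f$ of order $k$ lie there.  Two facts
about these classes and one commutation rule give everything.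

\<^item> Differentiation costs one power of $\delta$, for every real $\beta$: if $F \in A_\beta$ then
  $\partial_j F \in A_{\beta + p}$ (\<open>weighted_class_partial_deriv\<close>).  Up to a constant, $|F|^p$ has
  the sub-mean value property on balls for every $p > 0$ (\<open>powr_norm_submean_ball\<close>).  With
  Cauchy's formula this bounds $|\partial_j F(z)|^p$ by $\delta(z)^{-p}$ times the mean of $|F|^p$
  over a ball of radius $\delta(z)/2$, on which $\delta$ is nearly constant; then use Fubini
  (\<open>nn_integral_local_average_le\<close>).

\<^item> Radial differentiation can be undone, for $\beta > -1$: if $RF + cF \in A_{\beta + p}$ with
  an integer $c \ge 0$, then $F \in A_\beta$ (\<open>weighted_integral_radial_finite\<close>).  Fix a large
  $L$ and compare $F(z)$ with $t^c F(tz)$ for $1 - t$ between $L\delta(z)$ and $2L\delta(z)$.  The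
  $s$-derivative of $s^c F(sz)$ is $s^{c-1} (RF + cF)(sz)$, so the difference is controlled by
  $RF + cF$ at points whose distance from the sphere is comparable with $\delta(z)$.  The term $F(tz)$
  is not controlled by anything, but its average over $t$ contributes at most a constant times
  $L^{-\beta-1} \int |F|^p \delta^\beta$ (\<open>nn_integral_dilation_average_le\<close>): $\delta$ is
  about $L$ times smaller at $z$ than at $tz$, so the weight changes by about $L^{-\beta}$, and the
  points $z$ fill a layer about $L$ times thinner than the points $tz$ do.  As $\beta > -1$, a
  large $L$ makes this at most half of the left hand side.  In this form the argument never uses
  convexity, and so it covers $p < 1$ as well.

\<^item> On holomorphic functions $\partial_j (R + c) = (R + c + 1) \partial_j$
  (\<open>partial_deriv_radial\<close>).

Let $\beta = \alpha + pk > -1$.  If $R^k f \in A_\beta$ and $\partial$ is any derivative of order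
$k$, then $(R + k)^k \partial f = \partial R^k f$ lies in $A_{\beta + pk}$ by the first fact, and
the second one, used $k$ times, gives $\partial f \in A_\beta$.  Conversely, suppose that all
derivatives of order $k$ lie in $A_\beta$.  Since $R$ is a combination of the $\partial_j$ with
bounded coefficients, the second fact puts all derivatives of lower order in $A_\beta$ too, and
then the combination $R^k f$ of all these.  So for each admissible $k$ the two conditions agree.
Independence of $k$ is the first fact when $k$ increases by one and the second one, with $c = 0$,
when it decreases by one.\<close>

section \<open>Integral estimates on the unit ball of a Euclidean space\<close>

lemma powr_comparable:
  fixes x y M s :: real
  assumes "0 < x" "0 < y" "x \<le> M * y" "y \<le> M * x"
  shows "x powr s \<le> M powr \<bar>s\<bar> * y powr s"
proof (cases "s \<ge> 0")
  case True
  have "x powr s \<le> (M * y) powr s"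
    using assms True by (intro powr_mono2) auto
  moreover have "M > 0"
    using assms by (smt (verit) mult_nonpos_nonneg)
  ultimately show ?thesis
    using assms True by (simp add: powr_mult)
next
  case False
  have M: "M > 0"
    using assms by (smt (verit) mult_nonpos_nonneg)
  have "(M * x) powr s \<le> y powr s"
    using assms False M by (intro powr_mono2') auto
  hence "M powr s * x powr s \<le> y powr s"
    using assms M by (simp add: powr_mult)
  hence "M powr - s * (M powr s * x powr s) \<le> M powr - s * y powr s"
    by (intro mult_left_mono) auto
  moreover have "M powr - s * (M powr s * x powr s) = x powr s"
    using M by (simp add: powr_minus field_simps)
  ultimately show ?thesis
    using False by simp
qed

lemma nn_integral_lborel_affine:
  fixes f :: "'a::euclidean_space \<Rightarrow> ennreal"
  assumes [measurable]: "f \<in> borel_measurable borel" and "c \<noteq> 0"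
  shows "(\<integral>\<^sup>+x. f x \<partial>lborel) = ennreal (\<bar>c\<bar> ^ DIM('a)) * (\<integral>\<^sup>+x. f (t + c *\<^sub>R x) \<partial>lborel)"
  by (subst lborel_affine[OF assms(2), of t])
     (simp add: nn_integral_density nn_integral_distr nn_integral_cmult)

lemma nn_integral_lborel_shift:
  fixes f :: "'a::euclidean_space \<Rightarrow> ennreal"
  assumes "f \<in> borel_measurable borel"
  shows "(\<integral>\<^sup>+x. f (t + x) \<partial>lborel) = (\<integral>\<^sup>+x. f x \<partial>lborel)"
  using nn_integral_lborel_affine[OF assms, of 1 t] by simp

lemma nn_integral_lborel_reflect:
  fixes f :: "'a::euclidean_space \<Rightarrow> ennreal"
  assumes "f \<in> borel_measurable borel"
  shows "(\<integral>\<^sup>+x. f (t - x) \<partial>lborel) = (\<integral>\<^sup>+x. f x \<partial>lborel)"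
  using nn_integral_lborel_affine[OF assms, of "-1" t] by simp

text \<open>The measure enters only through its invariance under translations and reflections, by the argument
that proves Haar measure unique: evaluate $\int\!\!\int U(Tx) 1_B(Tx + y)\, dx\, dy$ for the unit ball
$B$ in both orders of integration.  As $T$ maps $B$ onto itself, the two values are $|B|$ times the
two sides.\<close>

lemma nn_integral_orthogonal_transformation:
  fixes U :: "'a::euclidean_space \<Rightarrow> ennreal" and T :: "'a \<Rightarrow> 'a"
  assumes T: "orthogonal_transformation T"
  assumes [measurable]: "U \<in> borel_measurable borel"
  shows "(\<integral>\<^sup>+x. U (T x) \<partial>lborel) = (\<integral>\<^sup>+x. U x \<partial>lborel)"
proof -
  have lin: "linear T" and nT: "norm (T x) = norm x" for x
    using T by (auto simp: orthogonal_transformation)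
  have [measurable]: "T \<in> borel_measurable borel"
    using lin by (intro borel_measurable_continuous_onI linear_continuous_on)
       (simp add: linear_conv_bounded_linear)
  define B where "B = (ball 0 1 :: 'a set)"
  have [measurable]: "B \<in> sets borel" by (simp add: B_def)
  have e1: "emeasure lborel B = ennreal (unit_ball_vol (DIM('a)))"
    unfolding B_def by (subst emeasure_ball) auto
  have fin: "emeasure lborel B \<noteq> \<infinity>" "emeasure lborel B \<noteq> 0"
    using unit_ball_vol_pos[of "real DIM('a)"] unfolding e1 by (auto simp: ennreal_eq_0_iff not_le)
  have "emeasure lborel B * (\<integral>\<^sup>+x. U (T x) \<partial>lborel)
      = (\<integral>\<^sup>+x. U (T x) * (\<integral>\<^sup>+y. indicator B (T x + y) \<partial>lborel) \<partial>lborel)"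
    by (subst nn_integral_lborel_shift) (simp_all add: nn_integral_cmult mult.commute)
  also have "\<dots> = (\<integral>\<^sup>+x. (\<integral>\<^sup>+y. U (T x) * indicator B (T x + y) \<partial>lborel) \<partial>lborel)"
    by (simp add: nn_integral_cmult)
  also have "\<dots> = (\<integral>\<^sup>+y. (\<integral>\<^sup>+x. U (T x) * indicator B (T x + y) \<partial>lborel) \<partial>lborel)"
    by (rule lborel_pair.Fubini') measurable
  also have "\<dots> = (\<integral>\<^sup>+y. (\<integral>\<^sup>+x. U (T x - y) * indicator B (T x) \<partial>lborel) \<partial>lborel)"
  proof (rule nn_integral_cong)
    fix y
    have "surj T"
      using linear_injective_imp_surjective[OF lin orthogonal_transformation_inj[OF T]] by simp
    then obtain y' where y': "T y' = y"
      by (metis surj_def)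
    have T_shift: "T (- y' + x) = T x - y" for x
      using y' linear_add[OF lin, of "- y'" x] linear_neg[OF lin, of y'] by simp
    have "(\<integral>\<^sup>+x. U (T x) * indicator B (T x + y) \<partial>lborel)
       = (\<integral>\<^sup>+x. U (T (- y' + x)) * indicator B (T (- y' + x) + y) \<partial>lborel)"
      by (rule nn_integral_lborel_shift[symmetric]) measurable
    also have "\<dots> = (\<integral>\<^sup>+x. U (T x - y) * indicator B (T x) \<partial>lborel)"
      by (simp only: T_shift diff_add_cancel)
    finally show "(\<integral>\<^sup>+x. U (T x) * indicator B (T x + y) \<partial>lborel)
        = (\<integral>\<^sup>+x. U (T x - y) * indicator B (T x) \<partial>lborel)" .
  qed
  also have "\<dots> = (\<integral>\<^sup>+x. (\<integral>\<^sup>+y. U (T x - y) * indicator B (T x) \<partial>lborel) \<partial>lborel)"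
    by (rule lborel_pair.Fubini'[symmetric]) measurable
  also have "\<dots> = (\<integral>\<^sup>+x. (\<integral>\<^sup>+y. U y \<partial>lborel) * indicator B x \<partial>lborel)"
    by (simp add: nn_integral_multc nn_integral_lborel_reflect B_def nT indicator_def)
  also have "\<dots> = emeasure lborel B * (\<integral>\<^sup>+x. U x \<partial>lborel)"
    by (simp add: nn_integral_cmult mult.commute[of _ "indicator B _"] nn_integral_multc)
  finally show ?thesis
    using fin by (simp add: ennreal_mult_cancel_left)
qed

text \<open>This relation collects the points $w$ that a local estimate at $z$ may involve.  The bounds are chosen
so that $\delta(w)$ and $\delta(z)$ are comparable, with constants depending on \<open>A\<close> only.\<close>

definition within_reach :: "real \<Rightarrow> 'a::real_normed_vector \<Rightarrow> 'a \<Rightarrow> bool" where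
  "within_reach A z w \<longleftrightarrow>
     norm z < 1 \<and> norm w < 1 \<and> dist z w \<le> A * (1 - norm z) \<and> 1 - norm z \<le> 2 * (1 - norm w)"

lemma within_reach_measurable [measurable (raw)]:
  assumes [measurable]: "f \<in> M \<rightarrow>\<^sub>M borel" "g \<in> M \<rightarrow>\<^sub>M borel"
  shows "Measurable.pred M (\<lambda>x. within_reach A (f x :: 'a::euclidean_space) (g x))"
  unfolding within_reach_def by measurable

text \<open>After exchanging the integrals, the points $z$ that see a given $w$ lie in a ball of radius about
$\delta(w)$, whose volume cancels the factor $\delta(z)^{-N}$, where $N$ is the dimension.\<close>

lemma nn_integral_local_average_le:
  fixes A \<gamma> :: real
  assumes A: "A \<ge> 1"
  shows "\<exists>C\<ge>0. \<forall>g\<in>borel_measurable borel.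
     (\<integral>\<^sup>+z. (\<integral>\<^sup>+w. ennreal ((1 - norm z) powr (\<gamma> - DIM('a))) * g w
          * indicator {w. within_reach A z w} w \<partial>lborel) \<partial>lborel)
     \<le> ennreal C * (\<integral>\<^sup>+w. indicator (ball 0 1) w * ennreal ((1 - norm w) powr \<gamma>) * g (w::'a::euclidean_space) \<partial>lborel)"
proof -
  define s where "s = \<gamma> - DIM('a)"
  define M where "M = A + 1"
  define C where "C = M powr \<bar>s\<bar> * (unit_ball_vol (DIM('a)) * (2 * A) ^ DIM('a))"
  have [measurable]: "ball (0::'a) 1 \<in> sets borel" by simp
  have C0: "C \<ge> 0"
    using A unfolding C_def M_def by (intro mult_nonneg_nonneg) auto
  have "(\<integral>\<^sup>+z. (\<integral>\<^sup>+w. ennreal ((1 - norm z) powr s) * g w * indicator {w. within_reach A z w} w \<partial>lborel) \<partial>lborel)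
     \<le> ennreal C * (\<integral>\<^sup>+w. indicator (ball 0 1) w * ennreal ((1 - norm w) powr \<gamma>) * g (w::'a) \<partial>lborel)"
    if [measurable]: "g \<in> borel_measurable borel" for g
  proof -
    have "(\<integral>\<^sup>+z. (\<integral>\<^sup>+w. ennreal ((1 - norm z) powr s) * g w * indicator {w. within_reach A z w} w \<partial>lborel) \<partial>lborel)
      = (\<integral>\<^sup>+w. (\<integral>\<^sup>+z. ennreal ((1 - norm z) powr s) * g w * indicator {w. within_reach A z w} w \<partial>lborel) \<partial>lborel)"
      by (rule lborel_pair.Fubini') measurable
    also have "\<dots> \<le> (\<integral>\<^sup>+w. ennreal C * (indicator (ball 0 1) w * ennreal ((1 - norm w) powr \<gamma>) * g w) \<partial>lborel)"
    proof (intro nn_integral_mono)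
      fix w :: 'a
      show "(\<integral>\<^sup>+z. ennreal ((1 - norm z) powr s) * g w * indicator {w. within_reach A z w} w \<partial>lborel)
         \<le> ennreal C * (indicator (ball 0 1) w * ennreal ((1 - norm w) powr \<gamma>) * g w)"
      proof (cases "norm w < 1")
        case False
        thus ?thesis by (simp add: within_reach_def)
      next
        case True
        define d where "d = 1 - norm w"
        have d: "d > 0" using True by (simp add: d_def)
        have "(\<integral>\<^sup>+z. ennreal ((1 - norm z) powr s) * g w * indicator {w. within_reach A z w} w \<partial>lborel)
          \<le> (\<integral>\<^sup>+z. (ennreal (M powr \<bar>s\<bar> * d powr s) * g w) * indicator (cball w (2 * A * d)) z \<partial>lborel)"
        proof (intro nn_integral_mono)
          fix z :: 'a
          show "ennreal ((1 - norm z) powr s) * g w * indicator {w. within_reach A z w} w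
             \<le> (ennreal (M powr \<bar>s\<bar> * d powr s) * g w) * indicator (cball w (2 * A * d)) z"
          proof (cases "within_reach A z w")
            case True
            hence R: "1 - norm z > 0" "dist z w \<le> A * (1 - norm z)" "1 - norm z \<le> 2 * d"
              by (auto simp: within_reach_def d_def)
            have "A * (1 - norm z) \<le> A * (2 * d)"
              using R A by (intro mult_left_mono) auto
            hence mem: "z \<in> cball w (2 * A * d)"
              using R by (simp add: dist_commute mult_ac)
            have "norm z \<le> norm w + dist z w"
              by (simp add: dist_norm norm_triangle_sub)
            hence "d \<le> M * (1 - norm z)"
              using R norm_triangle_ineq2[of z w] unfolding d_def M_def dist_norm by (simp add: algebra_simps)
            moreover have "2 * d \<le> M * d"
              using A d unfolding M_def by (intro mult_right_mono) auto
            moreover have "1 - norm z \<le> M * d" using R calculation by linarith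
            ultimately have "(1 - norm z) powr s \<le> M powr \<bar>s\<bar> * d powr s"
              using R d by (intro powr_comparable) auto
            thus ?thesis
              using mem by (simp add: indicator_def mult_right_mono ennreal_leI)
          qed (simp add: indicator_def)
        qed
        also have "\<dots> = ennreal (M powr \<bar>s\<bar> * d powr s) * g w * emeasure lborel (cball w (2 * A * d))"
          by (rule nn_integral_cmult_indicator) simp
        also have "emeasure lborel (cball w (2 * A * d)) = ennreal (unit_ball_vol (DIM('a)) * (2 * A * d) ^ DIM('a))"
          using A d by (intro emeasure_cball) auto
        also have "ennreal (M powr \<bar>s\<bar> * d powr s) * g w * \<dots>
            = ennreal ((M powr \<bar>s\<bar> * d powr s) * (unit_ball_vol (DIM('a)) * (2 * A * d) ^ DIM('a))) * g w"
          using A d by (simp add: ennreal_mult mult_ac)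
        also have "(M powr \<bar>s\<bar> * d powr s) * (unit_ball_vol (DIM('a)) * (2 * A * d) ^ DIM('a))
            = C * (d powr s * d powr (DIM('a)))"
          using d by (simp add: C_def power_mult_distrib powr_realpow mult_ac)
        also have "d powr s * d powr (DIM('a)) = d powr \<gamma>"
          by (simp add: s_def flip: powr_add)
        finally show ?thesis
          using True C0 d by (simp add: d_def ennreal_mult mult.assoc)
      qed
    qed
    also have "\<dots> = ennreal C * (\<integral>\<^sup>+w. indicator (ball 0 1) w * ennreal ((1 - norm w) powr \<gamma>) * g w \<partial>lborel)"
      by (rule nn_integral_cmult) measurable
    finally show ?thesis .
  qed
  thus ?thesis
    unfolding s_def using C0 by (intro exI[of _ C]) blast
qed

text \<open>The gain $L^{-\beta-1}$ is the heart of the radial estimate.  Substitute $w = tz$ and exchange the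
integrals.  For fixed $w$ the conditions force $1 - t$ to lie within $\delta(w)/L$ of $\delta(w)$, and
$\delta(z)$ to be comparable with $\delta(w)/L$.  So the integral over $t$ is of order
$(\delta(w)/L)^{\beta - 1} L^{-1} \cdot \delta(w)/L = L^{-\beta-1} \delta(w)^\beta$.  The condition
$L\delta(z) \le 1/4$ ensures $t \ge 1/2$, which bounds the Jacobian $t^{-N}$ of the substitution.\<close>

lemma nn_integral_dilation_average_le:
  fixes \<beta> :: real
  shows "\<exists>C\<ge>0. \<forall>L\<ge>1. \<forall>g\<in>borel_measurable borel.
     (\<integral>\<^sup>+z. (\<integral>\<^sup>+t. ennreal ((1 - norm z) powr (\<beta> - 1) / L) * g (t *\<^sub>R z)
         * indicator {t. norm z < 1 \<and> L * (1 - norm z) \<le> 1/4 \<and>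
              L * (1 - norm z) \<le> 1 - t \<and> 1 - t \<le> 2 * L * (1 - norm z)} t \<partial>lborel) \<partial>lborel)
     \<le> ennreal (C * L powr (- \<beta> - 1)) * (\<integral>\<^sup>+w. indicator (ball 0 1) w * ennreal ((1 - norm w) powr \<beta>) * g (w::'a::euclidean_space) \<partial>lborel)"
proof -
  define C where "C = 2 ^ DIM('a) * 4 powr \<bar>\<beta> - 1\<bar>"
  have [measurable]: "ball (0::'a) 1 \<in> sets borel" by simp
  have C0: "C \<ge> 0" unfolding C_def by (intro mult_nonneg_nonneg) auto
  have "(\<integral>\<^sup>+z. (\<integral>\<^sup>+t. ennreal ((1 - norm z) powr (\<beta> - 1) / L) * g (t *\<^sub>R z)
         * indicator {t. norm z < 1 \<and> L * (1 - norm z) \<le> 1/4 \<and>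
              L * (1 - norm z) \<le> 1 - t \<and> 1 - t \<le> 2 * L * (1 - norm z)} t \<partial>lborel) \<partial>lborel)
     \<le> ennreal (C * L powr (- \<beta> - 1)) * (\<integral>\<^sup>+w. indicator (ball 0 1) w * ennreal ((1 - norm w) powr \<beta>) * g (w::'a::euclidean_space) \<partial>lborel)"
    if L: "L \<ge> 1" and [measurable]: "g \<in> borel_measurable borel" for L g
  proof -
    define P where "P = (\<lambda>(z::'a) t. norm z < 1 \<and> L * (1 - norm z) \<le> 1/4 \<and>
              L * (1 - norm z) \<le> 1 - t \<and> 1 - t \<le> 2 * L * (1 - norm z))"
    define k where "k = (\<lambda>z t. ennreal ((1 - norm z) powr (\<beta> - 1) / L) * indicator {t. P z t} t)"
    have [measurable]: "(\<lambda>x. k (f x) (h x)) \<in> borel_measurable N"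
      if [measurable]: "f \<in> N \<rightarrow>\<^sub>M borel" "h \<in> N \<rightarrow>\<^sub>M borel" for f h and N :: "'c measure"
      unfolding k_def P_def indicator_def by simp
    have Pt: "1/2 \<le> t \<and> t < 1" if "P z t" for z t
    proof -
      have "0 < L * (1 - norm z)" using that L by (intro mult_pos_pos) (auto simp: P_def)
      thus ?thesis using that by (auto simp: P_def)
    qed
    have "(\<integral>\<^sup>+z. (\<integral>\<^sup>+t. k z t * g (t *\<^sub>R z) \<partial>lborel) \<partial>lborel) = (\<integral>\<^sup>+t. (\<integral>\<^sup>+z. k z t * g (t *\<^sub>R z) \<partial>lborel) \<partial>lborel)"
      by (rule lborel_pair.Fubini') measurable
    also have "\<dots> \<le> (\<integral>\<^sup>+t. (\<integral>\<^sup>+w. ennreal (2 ^ DIM('a)) * (k ((1/t) *\<^sub>R w) t * indicator {1/2..<1} t * g w) \<partial>lborel) \<partial>lborel)"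
    proof (rule nn_integral_mono)
      fix t :: real
      show "(\<integral>\<^sup>+z. k z t * g (t *\<^sub>R z) \<partial>lborel) \<le>
        (\<integral>\<^sup>+w. ennreal (2 ^ DIM('a)) * (k ((1/t) *\<^sub>R w) t * indicator {1/2..<1} t * g w) \<partial>lborel)"
      proof (cases "1/2 \<le> t \<and> t < 1")
        case False
        hence "\<not> P z t" for z using Pt[of z t] by blast
        hence "k z t = 0" for z by (simp add: k_def)
        thus ?thesis by simp
      next
        case True
        have "(\<integral>\<^sup>+z. k z t * g (t *\<^sub>R z) \<partial>lborel)
          = ennreal (\<bar>1/t\<bar> ^ DIM('a)) * (\<integral>\<^sup>+w. k (0 + (1/t) *\<^sub>R w) t * g (t *\<^sub>R (0 + (1/t) *\<^sub>R w)) \<partial>lborel)"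
          using True by (intro nn_integral_lborel_affine) auto
        also have "\<dots> = ennreal (\<bar>1/t\<bar> ^ DIM('a)) * (\<integral>\<^sup>+w. k ((1/t) *\<^sub>R w) t * indicator {1/2..<1} t * g w \<partial>lborel)"
          using True by simp
        also have "\<dots> \<le> ennreal (2 ^ DIM('a)) * (\<integral>\<^sup>+w. k ((1/t) *\<^sub>R w) t * indicator {1/2..<1} t * g w \<partial>lborel)"
          using True by (intro mult_right_mono ennreal_leI power_mono) (auto simp: field_simps)
        also have "\<dots> = (\<integral>\<^sup>+w. ennreal (2 ^ DIM('a)) * (k ((1/t) *\<^sub>R w) t * indicator {1/2..<1} t * g w) \<partial>lborel)"
          by (intro nn_integral_cmult[symmetric]) measurable
        finally show ?thesis .
      qed
    qed
    also have "\<dots> = (\<integral>\<^sup>+w. (\<integral>\<^sup>+t. ennreal (2 ^ DIM('a)) * (k ((1/t) *\<^sub>R w) t * indicator {1/2..<1} t * g w) \<partial>lborel) \<partial>lborel)"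
      by (rule lborel_pair.Fubini') measurable
    also have "\<dots> \<le> (\<integral>\<^sup>+w. ennreal (C * L powr (- \<beta> - 1)) * (indicator (ball 0 1) w * ennreal ((1 - norm w) powr \<beta>) * g w) \<partial>lborel)"
    proof (intro nn_integral_mono)
      fix w :: 'a
      define d where "d = 1 - norm w"
      define B where "B = 4 powr \<bar>\<beta> - 1\<bar> * (d / L) powr (\<beta> - 1) / L"
      have B0: "B \<ge> 0" using L by (auto simp: B_def)
      have pw: "k ((1/t) *\<^sub>R w) t * indicator {1/2..<1} t
          \<le> ennreal B * indicator (ball 0 1) w * indicator {1 - d..1 - d + d / L} t" for t
      proof (cases "P ((1/t) *\<^sub>R w) t \<and> 1/2 \<le> t \<and> t < 1")
        case True
        define e where "e = 1 - norm ((1/t) *\<^sub>R w)"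
        define u where "u = 1 - t"
        have t: "1/2 \<le> t" "t < 1" and u: "0 < u" "u \<le> 1/2" using True by (auto simp: u_def)
        have e: "0 < e" "L * e \<le> u" "u \<le> 2 * L * e"
          using True unfolding P_def e_def u_def by auto
        have e1: "e \<le> 1" by (simp add: e_def)
        have "norm w = t * (1 - e)"
          using t by (simp add: e_def)
        hence d_eq: "d = u + t * e"
          by (simp add: d_def u_def algebra_simps)
        have "t * e \<le> e" "0 < t * e" using t e by (auto intro: mult_left_le_one_le)
        hence d: "u \<le> d" "d \<le> u + e" "0 < d" using d_eq u by linarith+
        have "1 * e \<le> L * e" using L e by (intro mult_right_mono) auto
        hence "d \<le> 2 * u" using d e by linarith
        have "e \<le> 4 * (d / L)"
          using e d L by (simp add: field_simps)
        moreover have "d / L \<le> 4 * e"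
          using \<open>d \<le> 2 * u\<close> e L by (simp add: field_simps)
        ultimately have "e powr (\<beta> - 1) \<le> 4 powr \<bar>\<beta> - 1\<bar> * (d / L) powr (\<beta> - 1)"
          using e d L by (intro powr_comparable) auto
        hence le: "e powr (\<beta> - 1) / L \<le> B"
          unfolding B_def using L by (intro divide_right_mono) auto
        have "e \<le> d / L" using e d L by (simp add: field_simps)
        hence "t \<in> {1 - d..1 - d + d / L}"
          using d unfolding u_def by auto
        moreover have "w \<in> ball 0 1" using d by (simp add: d_def)
        ultimately show ?thesis
          using True le by (auto simp: k_def e_def intro!: ennreal_leI)
      qed (auto simp: k_def indicator_def)
      have "(\<integral>\<^sup>+t. ennreal (2 ^ DIM('a)) * (k ((1/t) *\<^sub>R w) t * indicator {1/2..<1} t * g w) \<partial>lborel)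
        \<le> (\<integral>\<^sup>+t. ennreal (2 ^ DIM('a)) * (ennreal B * indicator (ball 0 1) w * indicator {1 - d..1 - d + d / L} t * g w) \<partial>lborel)"
        by (intro nn_integral_mono mult_left_mono mult_right_mono pw) auto
      also have "\<dots> = (\<integral>\<^sup>+t. (ennreal (2 ^ DIM('a)) * (ennreal B * indicator (ball 0 1) w * g w)) * indicator {1 - d..1 - d + d / L} t \<partial>lborel)"
        by (simp add: mult_ac)
      also have "\<dots> = ennreal (2 ^ DIM('a)) * (ennreal B * indicator (ball 0 1) w * g w) * emeasure lborel {1 - d..1 - d + d / L}"
        by (subst nn_integral_cmult) auto
      also have "\<dots> = ennreal (C * L powr (- \<beta> - 1)) * (indicator (ball 0 1) w * ennreal ((1 - norm w) powr \<beta>) * g w)"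
      proof (cases "norm w < 1")
        case True
        hence d: "d > 0" by (simp add: d_def)
        have "2 ^ DIM('a) * B * (d / L) = C * ((d / L) powr (\<beta> - 1) * (d / L) powr 1) / L"
          using d L by (simp add: B_def C_def)
        also have "(d / L) powr (\<beta> - 1) * (d / L) powr 1 = (d / L) powr \<beta>"
          by (subst powr_add[symmetric]) simp
        also have "C * (d / L) powr \<beta> / L = C * L powr (- \<beta> - 1) * d powr \<beta>"
          using L d by (simp add: powr_divide powr_diff powr_minus divide_simps)
        finally have eq: "2 ^ DIM('a) * B * (d / L) = C * L powr (- \<beta> - 1) * d powr \<beta>" .
        have "ennreal (2 ^ DIM('a)) * (ennreal B * g w) * ennreal (d / L) = ennreal (2 ^ DIM('a) * B * (d / L)) * g w"
        proof -
          have "0 \<le> d / L" using d L by simp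
          thus ?thesis using B0 by (simp only: ennreal_mult zero_le_power zero_le_numeral mult_nonneg_nonneg mult_ac)
        qed
        also have "\<dots> = ennreal (C * L powr (- \<beta> - 1)) * (ennreal (d powr \<beta>) * g w)"
          unfolding eq using C0 by (simp add: ennreal_mult mult_ac)
        finally show ?thesis
          using True d L by (simp add: d_def)
      qed auto
      finally show "(\<integral>\<^sup>+t. ennreal (2 ^ DIM('a)) * (k ((1/t) *\<^sub>R w) t * indicator {1/2..<1} t * g w) \<partial>lborel)
         \<le> ennreal (C * L powr (- \<beta> - 1)) * (indicator (ball 0 1) w * ennreal ((1 - norm w) powr \<beta>) * g w)" .
    qed
    also have "\<dots> = ennreal (C * L powr (- \<beta> - 1)) * (\<integral>\<^sup>+w. indicator (ball 0 1) w * ennreal ((1 - norm w) powr \<beta>) * g w \<partial>lborel)"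
      by (rule nn_integral_cmult) measurable
    finally show ?thesis by (simp add: k_def P_def mult_ac)
  qed
  thus ?thesis using C0 by blast
qed

section \<open>Partial derivatives of holomorphic functions\<close>

text \<open>The circle is parametrised over $[0,1]$, so that both formulas become integrals over a fixed compact
interval that can be differentiated in a parameter or averaged with Fubini.\<close>

lemma cauchy_circle:
  assumes h: "h holomorphic_on cball 0 r" and r: "r > 0"
  shows mean_value_circle: "((\<lambda>x. h (of_real r * cis (2 * pi * x))) has_integral h 0) {0..1}"
    and deriv_circle: "((\<lambda>x. h (of_real r * cis (2 * pi * x)) / cis (2 * pi * x)) has_integral of_real r * deriv h 0) {0..1}"
proof -
  have e: "exp (2 * of_real pi * \<i> * of_real x) = cis (2 * pi * x)" for x :: real
    by (simp add: cis_conv_exp mult_ac)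
  have c: "circlepath 0 r x = of_real r * cis (2 * pi * x)" for x
    by (simp add: circlepath e)
  have v: "vector_derivative (circlepath 0 r) (at x) = 2 * of_real pi * \<i> * of_real r * cis (2 * pi * x)" for x
    by (simp add: vector_derivative_circlepath e)
  have "((\<lambda>u. h u / (u - 0)) has_contour_integral (2 * of_real pi * \<i> * h 0)) (circlepath 0 r)"
    using r by (intro Cauchy_integral_circlepath_simple h) auto
  hence "((\<lambda>x. h (of_real r * cis (2 * pi * x)) * (2 * of_real pi * \<i>)) has_integral (h 0 * (2 * of_real pi * \<i>))) {0..1}"
    unfolding has_contour_integral c v using r by (simp add: mult_ac)
  from has_integral_divide[OF this, of "2 * of_real pi * \<i>"]
  show "((\<lambda>x. h (of_real r * cis (2 * pi * x))) has_integral h 0) {0..1}"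
    by simp
  have "((\<lambda>u. h u / (u - 0) ^ (Suc 1)) has_contour_integral (2 * pi * \<i> / fact 1) * (deriv ^^ 1) h 0) (circlepath 0 r)"
    using r by (intro Cauchy_has_contour_integral_higher_derivative_circlepath
        holomorphic_on_imp_continuous_on[OF h] holomorphic_on_subset[OF h]) auto
  hence "((\<lambda>x. h (of_real r * cis (2 * pi * x)) / cis (2 * pi * x) * (2 * of_real pi * \<i> / of_real r)) has_integral
      (2 * of_real pi * \<i> * deriv h 0)) {0..1}"
    unfolding has_contour_integral c v using r by (simp add: mult_ac power2_eq_square)
  from has_integral_divide[OF this, of "2 * of_real pi * \<i> / of_real r"]
  show "((\<lambda>x. h (of_real r * cis (2 * pi * x)) / cis (2 * pi * x)) has_integral of_real r * deriv h 0) {0..1}"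
    using r by (simp add: mult_ac)
qed

lemma axis_eq_vector_scalar_mult: "axis k w = w *s axis k (1::complex)"
  by (simp add: vec_eq_iff axis_def)

lemma norm_axis_complex [simp]: "norm (axis k w :: complex ^ 'n) = norm w"
proof -
  have "(\<Sum>i\<in>UNIV. (norm ((axis k w :: complex ^ 'n) $ i))\<^sup>2) = (\<Sum>i\<in>UNIV. if i = k then (norm w)\<^sup>2 else 0)"
    by (intro sum.cong) (auto simp: axis_def)
  thus ?thesis by (simp add: norm_vec_def L2_set_def)
qed

lemma norm_vector_scalar_mult_complex: "norm (c *s (v :: complex ^ 'n)) = norm c * norm v"
  by (simp add: norm_vec_def L2_set_def norm_mult power_mult_distrib flip: sum_distrib_left)
     (simp add: real_sqrt_mult)

lemma bounded_linear_vector_scalar_mult: "bounded_linear (\<lambda>c. c *s (v :: complex ^ 'n))"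
  by (rule bounded_linear_intro[where K = "norm v"])
     (auto simp: norm_vector_scalar_mult_complex vec_eq_iff algebra_simps)

lemma has_derivative_slice:
  assumes "(F has_derivative D) (at (z + w *s v))" and "\<And>c v. D (c *s v) = c * D v"
  shows "((\<lambda>w. F (z + w *s v)) has_field_derivative D (v :: complex ^ 'n)) (at w)"
proof -
  have "((\<lambda>w. F (z + w *s v)) has_derivative (\<lambda>c. D (c *s v))) (at w)"
    by (rule has_derivative_compose[where g = F and f = "\<lambda>w. z + w *s v", OF _ assms(1)])
       (auto intro!: derivative_eq_intros bounded_linear.has_derivative[OF bounded_linear_vector_scalar_mult])
  moreover have "(\<lambda>c. D (c *s v)) = (*) (D v)"
    by (simp add: fun_eq_iff assms(2))
  ultimately show ?thesis
    by (simp add: has_field_derivative_def)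
qed

text \<open>With this rule a partial derivative is read off from any complex linear derivative that the
differentiation rules produce.\<close>

lemma partial_deriv_eqI:
  assumes "(F has_derivative D) (at z)" and "\<And>c v. D (c *s v) = c * D v"
  shows "partial_deriv k F z = D (axis k 1)"
proof -
  have "((\<lambda>w. F (z + w *s axis k 1)) has_field_derivative D (axis k 1)) (at 0)"
    using assms by (intro has_derivative_slice) auto
  thus ?thesis
    unfolding partial_deriv_def by (subst axis_eq_vector_scalar_mult) (rule DERIV_imp_deriv)
qed

lemma holomorphic_vec_onE:
  assumes "holomorphic_vec_on F S" "open S" "z \<in> S"
  obtains D where "(F has_derivative D) (at z)" "\<And>c v. D (c *s v) = c * D v"
  using assms unfolding holomorphic_vec_on_def by (metis at_within_open)

lemma holomorphic_vec_onI:
  assumes "\<And>z. z \<in> S \<Longrightarrow> \<exists>D. (F has_derivative D) (at z) \<and> (\<forall>c v. D (c *s v) = c * D v)"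
  shows "holomorphic_vec_on F S"
  unfolding holomorphic_vec_on_def using assms has_derivative_at_withinI by blast

lemma holomorphic_vec_on_has_derivative:
  assumes "holomorphic_vec_on F S" "open S" "z \<in> S"
  shows "(F has_derivative (\<lambda>v. \<Sum>k\<in>UNIV. v $ k * partial_deriv k F z)) (at z)"
proof -
  obtain D where D: "(F has_derivative D) (at z)" "\<And>c v. D (c *s v) = c * D v"
    using holomorphic_vec_onE[OF assms] by blast
  have lin: "linear D" using D(1) by (simp add: has_derivative_bounded_linear bounded_linear.linear)
  have "D v = (\<Sum>k\<in>UNIV. v $ k * partial_deriv k F z)" for v
  proof -
    have "v = (\<Sum>k\<in>UNIV. v $ k *s axis k 1)"
      by (simp add: basis_expansion)
    hence "D v = (\<Sum>k\<in>UNIV. D (v $ k *s axis k 1))"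
      using linear_sum[OF lin] by metis
    thus ?thesis by (simp add: D(2) partial_deriv_eqI[OF D])
  qed
  thus ?thesis using D(1) by presburger
qed

lemma holomorphic_vec_on_slice:
  assumes "holomorphic_vec_on F S" "open S" "z + w *s v \<in> S"
  shows "((\<lambda>w. F (z + w *s v)) has_field_derivative (\<Sum>k\<in>UNIV. v $ k * partial_deriv k F (z + w *s v))) (at w)"
  by (rule has_derivative_slice[OF holomorphic_vec_on_has_derivative[OF assms]])
     (simp add: sum_distrib_left mult_ac)

lemma holomorphic_vec_on_continuous:
  assumes "holomorphic_vec_on F S" shows "continuous_on S F"
  using assms unfolding holomorphic_vec_on_def
  by (meson continuous_on_eq_continuous_within has_derivative_continuous)

lemma holomorphic_vec_on_slice_holomorphic:
  assumes "holomorphic_vec_on F S" "open S" "\<And>w. w \<in> A \<Longrightarrow> z + w *s v \<in> S"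
  shows "(\<lambda>w. F (z + w *s v)) holomorphic_on A"
  unfolding holomorphic_on_def field_differentiable_def
  using holomorphic_vec_on_slice[OF assms(1,2) assms(3)] has_field_derivative_at_within by blast

text \<open>Cauchy's formula in the single variable $z_k$ writes $\partial_k F$ as an average of values of $F$.
Regularity of $\partial_k F$ is thereby inherited from that of $F$.\<close>

lemma partial_deriv_circle:
  fixes z :: "complex ^ 'n"
  assumes F: "holomorphic_vec_on F S" "open S" and r: "r > 0" "cball z r \<subseteq> S"
  shows "((\<lambda>x. F (z + axis k (of_real r * cis (2 * pi * x))) / cis (2 * pi * x)) has_integral
           of_real r * partial_deriv k F z) {0..1}"
proof -
  have "z + w *s axis k 1 \<in> S" if "w \<in> cball 0 r" for w
    using that r by (intro subsetD[OF r(2)]) (auto simp: dist_norm norm_vector_scalar_mult_complex)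
  hence "(\<lambda>w. F (z + w *s axis k 1)) holomorphic_on cball 0 r"
    by (intro holomorphic_vec_on_slice_holomorphic[OF F])
  from deriv_circle[OF this r(1)] show ?thesis
    unfolding partial_deriv_def by (simp flip: axis_eq_vector_scalar_mult)
qed

lemma circle_shift_continuous:
  fixes z0 :: "complex ^ 'n"
  assumes "continuous_on S G" "r > 0" "cball z0 (2 * r) \<subseteq> S"
  shows "continuous_on (ball z0 r \<times> {0..1}) (\<lambda>(z, x). G (z + axis k (of_real r * cis (2 * pi * x))) / cis (2 * pi * x))"
proof -
  have ax: "continuous_on T (\<lambda>p. axis k (g p) :: complex ^ 'n)" if "continuous_on T g" for T :: "'b::topological_space set" and g
    by (subst axis_eq_vector_scalar_mult)
       (rule continuous_on_compose2[OF linear_continuous_on[OF bounded_linear_vector_scalar_mult] that subset_UNIV])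
  have inS: "z + axis k (of_real r * cis (2 * pi * x)) \<in> S" if "z \<in> ball z0 r" for z x
  proof (rule subsetD[OF assms(3)])
    have "dist z0 (z + axis k (of_real r * cis (2 * pi * x))) \<le> dist z0 z + dist z (z + axis k (of_real r * cis (2 * pi * x)))"
      by (rule dist_triangle)
    thus "z + axis k (of_real r * cis (2 * pi * x)) \<in> cball z0 (2 * r)"
      using that assms(2) by (simp add: dist_norm norm_mult)
  qed
  have c: "continuous_on (ball z0 r \<times> {0..1}) (\<lambda>p. cis (2 * pi * snd p))"
    by (intro continuous_intros)
  have "continuous_on (ball z0 r \<times> {0..1}) (\<lambda>p. fst p + axis k (of_real r * cis (2 * pi * snd p)))"
    by (intro continuous_on_add continuous_on_fst continuous_on_id ax continuous_on_mult continuous_on_const c)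
  hence "continuous_on (ball z0 r \<times> {0..1}) (\<lambda>p. G (fst p + axis k (of_real r * cis (2 * pi * snd p))))"
    by (rule continuous_on_compose2[OF assms(1)]) (auto intro: inS)
  hence "continuous_on (ball z0 r \<times> {0..1}) (\<lambda>p. G (fst p + axis k (of_real r * cis (2 * pi * snd p))) / cis (2 * pi * snd p))"
    using c by (intro continuous_on_divide) auto
  thus ?thesis by (simp add: case_prod_unfold)
qed

lemma continuous_on_partial_deriv:
  fixes S :: "(complex ^ 'n) set"
  assumes F: "holomorphic_vec_on F S" "open S"
  shows "continuous_on S (partial_deriv k F)"
proof -
  have "\<exists>e>0. continuous_on (ball z0 e) (partial_deriv k F)" if z0: "z0 \<in> S" for z0
  proof -
    obtain R where R: "R > 0" "cball z0 R \<subseteq> S" using F(2) z0 open_contains_cball by blast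
    define r where "r = R / 2"
    have r: "r > 0" "cball z0 (2 * r) \<subseteq> S" using R by (auto simp: r_def)
    have "continuous_on (ball z0 r) (\<lambda>z. integral (cbox 0 1) (\<lambda>x. F (z + axis k (of_real r * cis (2 * pi * x))) / cis (2 * pi * x)) / of_real r)"
      using circle_shift_continuous[OF holomorphic_vec_on_continuous[OF F(1)] r, of k] r(1)
      by (intro continuous_intros integral_continuous_on_param) auto
    moreover have "integral (cbox 0 1) (\<lambda>x. F (z + axis k (of_real r * cis (2 * pi * x))) / cis (2 * pi * x)) / of_real r
        = partial_deriv k F z" if z: "z \<in> ball z0 r" for z
    proof -
      have "cball z r \<subseteq> cball z0 (2 * r)"
        using z by (subst cball_subset_cball_iff) (auto simp: dist_commute)
      hence "cball z r \<subseteq> S" using r by blast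
      from integral_unique[OF partial_deriv_circle[OF F r(1) this, of k]] show ?thesis using r by simp
    qed
    ultimately have "continuous_on (ball z0 r) (partial_deriv k F)"
      by (rule continuous_on_eq)
    thus ?thesis using r by blast
  qed
  hence "continuous (at z0) (partial_deriv k F)" if "z0 \<in> S" for z0
    using that by (metis centre_in_ball continuous_on_eq_continuous_at open_ball)
  thus ?thesis by (intro continuous_at_imp_continuous_on) auto
qed

text \<open>Differentiation under the integral sign in Cauchy's formula.  It needs a continuous total derivative
of $F$, which continuity of the partial derivatives supplies.  The resulting formula shows both
that $\partial_k F$ is again holomorphic and that mixed partial derivatives commute.\<close>

lemma partial_deriv_circle_derivative:
  fixes S :: "(complex ^ 'n) set"
  assumes F: "holomorphic_vec_on F S" "open S" and r: "r > 0" "cball z0 (2 * r) \<subseteq> S"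
  shows "(partial_deriv k F has_derivative (\<lambda>v. integral {0..1} (\<lambda>x.
      (\<Sum>j\<in>UNIV. v $ j * partial_deriv j F (z0 + axis k (of_real r * cis (2 * pi * x)))) / cis (2 * pi * x)) / of_real r)) (at z0)"
proof -
  define fx where "fx = (\<lambda>z x. Blinfun (\<lambda>v. (\<Sum>j\<in>UNIV. v $ j * partial_deriv j F (z + axis k (of_real r * cis (2 * pi * x)))) / cis (2 * pi * x)))"
  define U where "U = ball z0 r"
  have inS: "z + axis k (of_real r * cis (2 * pi * x)) \<in> S" if "z \<in> U" for z x
  proof (rule subsetD[OF r(2)])
    have "dist z0 (z + axis k (of_real r * cis (2 * pi * x))) \<le> dist z0 z + dist z (z + axis k (of_real r * cis (2 * pi * x)))"
      by (rule dist_triangle)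
    thus "z + axis k (of_real r * cis (2 * pi * x)) \<in> cball z0 (2 * r)"
      using that r(1) by (simp add: dist_norm norm_mult U_def)
  qed
  have Pair_cont: "continuous_on {0..1} (\<lambda>x::real. (z, x))" for z :: "complex ^ 'n"
    by (intro continuous_intros)
  have bl: "bounded_linear (\<lambda>v. (\<Sum>j\<in>UNIV. v $ j * g j) / c)" for g :: "'n \<Rightarrow> complex" and c
    unfolding divide_inverse
    by (intro bounded_linear_mult_const bounded_linear_sum bounded_linear_vec_nth)
  have fx_apply: "blinfun_apply (fx z x) v = (\<Sum>j\<in>UNIV. v $ j * partial_deriv j F (z + axis k (of_real r * cis (2 * pi * x)))) / cis (2 * pi * x)" for z x v
    unfolding fx_def by (subst bounded_linear_Blinfun_apply) (rule bl, rule refl)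
  have cont_fx: "continuous_on (U \<times> cbox 0 1) (\<lambda>(z, x). fx z x)"
  proof -
    have "continuous_on (U \<times> cbox 0 1) (\<lambda>p. blinfun_apply (case p of (z, x) \<Rightarrow> fx z x) i)" for i
    proof -
      have "continuous_on (U \<times> {0..1}) (\<lambda>p. \<Sum>j\<in>UNIV. i $ j * (case p of (z, x) \<Rightarrow> partial_deriv j F (z + axis k (of_real r * cis (2 * pi * x))) / cis (2 * pi * x)))"
        unfolding U_def by (intro continuous_intros circle_shift_continuous[OF continuous_on_partial_deriv[OF F] r])
      thus ?thesis
        by (simp add: case_prod_unfold fx_apply sum_divide_distrib)
    qed
    thus ?thesis by (intro continuous_on_blinfun_componentwise)
  qed
  have "((\<lambda>z. integral (cbox 0 1) (\<lambda>x. F (z + axis k (of_real r * cis (2 * pi * x))) / cis (2 * pi * x)))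
      has_derivative integral (cbox 0 1) (fx z0)) (at z0 within U)"
  proof (rule leibniz_rule[OF _ _ cont_fx])
    fix z and x :: real assume z: "z \<in> U"
    have "((\<lambda>z. F (z + axis k (of_real r * cis (2 * pi * x)))) has_derivative
        (\<lambda>v. \<Sum>j\<in>UNIV. v $ j * partial_deriv j F (z + axis k (of_real r * cis (2 * pi * x))))) (at z)"
      by (rule has_derivative_compose[where g = F and f = "\<lambda>z. z + axis k (of_real r * cis (2 * pi * x))", OF _ holomorphic_vec_on_has_derivative[OF F inS[OF z]]])
         (auto intro!: derivative_eq_intros)
    hence "((\<lambda>z. F (z + axis k (of_real r * cis (2 * pi * x))) / cis (2 * pi * x)) has_derivative
        blinfun_apply (fx z x)) (at z)"
      unfolding fx_apply[abs_def] by (intro bounded_linear.has_derivative[OF bounded_linear_divide])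
    thus "((\<lambda>z. F (z + axis k (of_real r * cis (2 * pi * x))) / cis (2 * pi * x)) has_derivative
        blinfun_apply (fx z x)) (at z within U)"
      by (rule has_derivative_at_withinI)
  next
    fix z assume z: "z \<in> U"
    have "continuous_on {0..1} (\<lambda>x. F (z + axis k (of_real r * cis (2 * pi * x))) / cis (2 * pi * x))"
    proof -
      have "Pair z ` {0..1} \<subseteq> ball z0 r \<times> {0..1}" using z by (auto simp: U_def)
      from continuous_on_compose2[OF circle_shift_continuous[OF holomorphic_vec_on_continuous[OF F(1)] r, of k] Pair_cont this]
      show ?thesis by simp
    qed
    thus "(\<lambda>x. F (z + axis k (of_real r * cis (2 * pi * x))) / cis (2 * pi * x)) integrable_on cbox 0 1"
      by (simp add: integrable_continuous_interval)
  qed (use r in \<open>auto simp: U_def\<close>)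
  hence "((\<lambda>z. integral (cbox 0 1) (\<lambda>x. F (z + axis k (of_real r * cis (2 * pi * x))) / cis (2 * pi * x)))
      has_derivative integral (cbox 0 1) (fx z0)) (at z0)"
    using at_within_open[of z0 U] r(1) by (simp add: U_def)
  from bounded_linear.has_derivative[OF bounded_linear_divide this, of "of_real r"]
  have 1: "((\<lambda>z. integral (cbox 0 1) (\<lambda>x. F (z + axis k (of_real r * cis (2 * pi * x))) / cis (2 * pi * x)) / of_real r)
      has_derivative (\<lambda>v. integral (cbox 0 1) (fx z0) v / of_real r)) (at z0)" .
  have "(partial_deriv k F has_derivative (\<lambda>v. integral (cbox 0 1) (fx z0) v / of_real r)) (at z0)"
  proof (rule has_derivative_transform_within_open[OF 1])
    fix z assume z: "z \<in> U"
    have "cball z r \<subseteq> cball z0 (2 * r)"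
      using z by (subst cball_subset_cball_iff) (auto simp: dist_commute U_def)
    hence "cball z r \<subseteq> S" using r by blast
    from integral_unique[OF partial_deriv_circle[OF F r(1) this, of k]]
    show "integral (cbox 0 1) (\<lambda>x. F (z + axis k (of_real r * cis (2 * pi * x))) / cis (2 * pi * x)) / of_real r
        = partial_deriv k F z" using r by simp
  qed (use r in \<open>auto simp: U_def\<close>)
  moreover have "integral (cbox 0 1) (fx z0) v = integral {0..1} (\<lambda>x.
      (\<Sum>j\<in>UNIV. v $ j * partial_deriv j F (z0 + axis k (of_real r * cis (2 * pi * x)))) / cis (2 * pi * x))" for v
  proof -
    have "continuous_on {0..1} (fx z0)"
    proof -
      have "Pair z0 ` {0..1::real} \<subseteq> U \<times> cbox 0 1" using r by (auto simp: U_def)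
      from continuous_on_compose2[OF cont_fx Pair_cont this] show ?thesis by simp
    qed
    hence "fx z0 integrable_on {0..1}" by (rule integrable_continuous_interval)
    from blinfun_apply_integral[OF this, of v] show ?thesis by (simp add: fx_apply)
  qed
  ultimately show ?thesis by simp
qed

lemma holomorphic_vec_on_partial_deriv:
  fixes S :: "(complex ^ 'n) set"
  assumes F: "holomorphic_vec_on F S" "open S"
  shows "holomorphic_vec_on (partial_deriv k F) S"
proof (rule holomorphic_vec_onI)
  fix z assume "z \<in> S"
  then obtain R where R: "R > 0" "cball z R \<subseteq> S" using F(2)[unfolded open_contains_cball] by blast
  have r: "R / 2 > 0" "cball z (2 * (R / 2)) \<subseteq> S" using R by auto
  show "\<exists>D. (partial_deriv k F has_derivative D) (at z) \<and> (\<forall>c v. D (c *s v) = c * D v)"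
    by (rule exI, rule conjI[OF partial_deriv_circle_derivative[OF F r]])
       (simp add: mult.assoc flip: sum_distrib_left times_divide_eq_right)
qed

text \<open>By the previous formula $\partial_j \partial_k F$ is the Cauchy integral in $z_k$ of
$\partial_j F$, and this is $\partial_k$ of the holomorphic function $\partial_j F$.\<close>

lemma partial_deriv_commute:
  fixes S :: "(complex ^ 'n) set"
  assumes F: "holomorphic_vec_on F S" "open S" and z: "z \<in> S"
  shows "partial_deriv j (partial_deriv k F) z = partial_deriv k (partial_deriv j F) z"
proof -
  obtain R where R: "R > 0" "cball z R \<subseteq> S" using F(2)[unfolded open_contains_cball] z by blast
  define r where "r = R / 2"
  have r: "r > 0" "cball z (2 * r) \<subseteq> S" "cball z r \<subseteq> S" using R by (auto simp: r_def)
  have sum_axis: "(\<Sum>i\<in>UNIV. (axis j 1 :: complex ^ 'n) $ i * g i) = g j" for g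
  proof -
    have "(\<Sum>i\<in>UNIV. (axis j 1 :: complex ^ 'n) $ i * g i) = (\<Sum>i\<in>UNIV. if i = j then g i else 0)"
      by (intro sum.cong) (auto simp: axis_def)
    thus ?thesis by simp
  qed
  have "partial_deriv j (partial_deriv k F) z = integral {0..1} (\<lambda>x.
      (\<Sum>i\<in>UNIV. (axis j 1 :: complex ^ 'n) $ i * partial_deriv i F (z + axis k (of_real r * cis (2 * pi * x)))) / cis (2 * pi * x)) / of_real r"
    by (rule partial_deriv_eqI[OF partial_deriv_circle_derivative[OF F r(1,2)]])
       (simp add: mult.assoc flip: sum_distrib_left times_divide_eq_right)
  also have "\<dots> = partial_deriv k (partial_deriv j F) z"
    using integral_unique[OF partial_deriv_circle[OF holomorphic_vec_on_partial_deriv[OF F, of j] F(2) r(1,3), of k]] r(1)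
    by (simp add: sum_axis)
  finally show ?thesis .
qed

lemma partial_deriv_cong:
  fixes S :: "(complex ^ 'n) set"
  assumes "open S" "z \<in> S" "\<And>w. w \<in> S \<Longrightarrow> F w = G w"
  shows "partial_deriv k F z = partial_deriv k G z"
proof -
  have "open ((\<lambda>w. z + w *s axis k 1) -` S)"
    by (intro open_vimage assms continuous_intros linear_continuous_on bounded_linear_vector_scalar_mult)
  hence "eventually (\<lambda>w. w \<in> (\<lambda>w. z + w *s axis k 1) -` S) (nhds 0)"
    using assms(2) by (intro eventually_nhds_in_open) auto
  hence "eventually (\<lambda>w. F (z + axis k w) = G (z + axis k w)) (nhds 0)"
    by eventually_elim (subst (1 2) axis_eq_vector_scalar_mult, auto intro: assms)
  thus ?thesis unfolding partial_deriv_def by (intro deriv_cong_ev refl)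
qed

lemma holomorphic_vec_on_cong:
  assumes "open S" "\<And>w. w \<in> S \<Longrightarrow> F w = G w" "holomorphic_vec_on F S"
  shows "holomorphic_vec_on G S"
proof (rule holomorphic_vec_onI)
  fix z assume z: "z \<in> S"
  obtain D where D: "(F has_derivative D) (at z)" "\<And>c v. D (c *s v) = c * D v"
    using holomorphic_vec_onE[OF assms(3,1) z] by blast
  thus "\<exists>D. (G has_derivative D) (at z) \<and> (\<forall>c v. D (c *s v) = c * D v)"
    using has_derivative_transform_within_open[OF D(1) assms(1) z] assms(2) by blast
qed

text \<open>Applying $\partial_j$ to $\sum_k z_k \partial_k F$ gives $\sum_k z_k \partial_j \partial_k F$
and the extra term $\partial_j F$ from the factor $z_j$; the constant therefore grows by one.\<close>

lemma partial_deriv_radial: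
  fixes S :: "(complex ^ 'n) set"
  assumes F: "holomorphic_vec_on F S" "open S"
  shows holomorphic_vec_on_radial: "holomorphic_vec_on (\<lambda>z. radial_deriv F z + c * F z) S"
    and "z \<in> S \<Longrightarrow> partial_deriv j (\<lambda>z. radial_deriv F z + c * F z) z =
           radial_deriv (partial_deriv j F) z + (c + 1) * partial_deriv j F z"
proof -
  define D where "D = (\<lambda>(z::complex ^ 'n) v. (\<Sum>k\<in>UNIV. z $ k * (\<Sum>i\<in>UNIV. v $ i * partial_deriv i (partial_deriv k F) z)
       + v $ k * partial_deriv k F z) + c * (\<Sum>i\<in>UNIV. v $ i * partial_deriv i F z))"
  have D: "((\<lambda>z. radial_deriv F z + c * F z) has_derivative D z) (at z)" if z: "z \<in> S" for z
    unfolding radial_deriv_def D_def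
    by (intro derivative_intros holomorphic_vec_on_has_derivative[OF F z]
        holomorphic_vec_on_has_derivative[OF holomorphic_vec_on_partial_deriv[OF F] F(2) z]
        bounded_linear.has_derivative[OF bounded_linear_vec_nth])
  have lin: "D z (a *s v) = a * D z v" for z a v
    by (simp add: D_def sum_distrib_left algebra_simps flip: sum.distrib)
  show "holomorphic_vec_on (\<lambda>z. radial_deriv F z + c * F z) S"
    using D lin by (intro holomorphic_vec_onI) blast
  assume z: "z \<in> S"
  have sum_axis: "(\<Sum>i\<in>UNIV. (axis j 1 :: complex ^ 'n) $ i * g i) = g j" for g
  proof -
    have "(\<Sum>i\<in>UNIV. (axis j 1 :: complex ^ 'n) $ i * g i) = (\<Sum>i\<in>UNIV. if i = j then g i else 0)"
      by (intro sum.cong) (auto simp: axis_def)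
    thus ?thesis by simp
  qed
  have "partial_deriv j (\<lambda>z. radial_deriv F z + c * F z) z = D z (axis j 1)"
    by (rule partial_deriv_eqI[OF D[OF z] lin])
  also have "\<dots> = (\<Sum>k\<in>UNIV. z $ k * partial_deriv k (partial_deriv j F) z) + (c + 1) * partial_deriv j F z"
    unfolding D_def sum.distrib sum_axis by (simp add: partial_deriv_commute[OF F z, of j] algebra_simps)
  finally show "partial_deriv j (\<lambda>z. radial_deriv F z + c * F z) z =
           radial_deriv (partial_deriv j F) z + (c + 1) * partial_deriv j F z"
    by (simp add: radial_deriv_def)
qed

section \<open>The sub-mean value property for all positive exponents\<close>

lemma borel_measurable_indicator_times_continuous:
  fixes h :: "'a::euclidean_space \<Rightarrow> real"
  assumes "continuous_on S h" "open S"
  shows "(\<lambda>x. indicator S x * ennreal (h x)) \<in> borel_measurable borel"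
proof -
  have "(\<lambda>x. indicator S x *\<^sub>R h x) \<in> borel_measurable borel"
    using assms by (intro borel_measurable_continuous_on_indicator) auto
  hence "(\<lambda>x. ennreal (indicator S x *\<^sub>R h x)) \<in> borel_measurable borel"
    by measurable
  moreover have "ennreal (indicator S x *\<^sub>R h x) = indicator S x * ennreal (h x)" for x
    by (simp add: indicator_def)
  ultimately show ?thesis by simp
qed

text \<open>For each $v$ the mean value property on the complex line through $z$ and $z + v$ gives
$|F(z)| \le \int_0^1 |F(z + e^{2 \pi i x} v)|\, dx$.  Integrate over $v$ in the ball: after an
exchange of integrals each rotation $v \mapsto e^{2 \pi i x} v$ disappears, because it preserves
volume.\<close>

lemma norm_submean_ball:
  fixes z :: "complex ^ 'n"
  assumes F: "holomorphic_vec_on F S" "open S" and \<rho>: "\<rho> > 0" "cball z \<rho> \<subseteq> S"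
  shows "ennreal (norm (F z) * (unit_ball_vol (DIM(complex ^ 'n)) * \<rho> ^ DIM(complex ^ 'n)))
           \<le> (\<integral>\<^sup>+w. indicator (ball z \<rho>) w * ennreal (norm (F w)) \<partial>lborel)"
proof -
  define U where "U = (\<lambda>v. indicator (ball 0 \<rho>) v * ennreal (norm (F (z + v))))"
  have "continuous_on (ball 0 \<rho>) (\<lambda>v. norm (F (z + v)))"
    using \<rho>(2) by (intro continuous_intros continuous_on_compose2[OF holomorphic_vec_on_continuous[OF F(1)]])
      (auto simp: subset_iff dist_norm)
  hence U [measurable]: "U \<in> borel_measurable borel"
    unfolding U_def by (intro borel_measurable_indicator_times_continuous) auto
  have circ [measurable]: "(\<lambda>(v, x). cis (2 * pi * x) *s v) \<in> (borel \<Otimes>\<^sub>M borel) \<rightarrow>\<^sub>M (borel :: (complex ^ 'n) measure)"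
  proof -
    have "continuous_on UNIV (\<lambda>p :: (complex ^ 'n) \<times> real. \<chi> i. cis (2 * pi * snd p) * fst p $ i)"
      by (intro continuous_on_vec_lambda continuous_intros)
    thus ?thesis
      by (auto simp: borel_prod vector_scalar_mult_def case_prod_unfold intro!: borel_measurable_continuous_onI)
  qed
  have pw: "ennreal (norm (F z)) * indicator (ball 0 \<rho>) v
      \<le> (\<integral>\<^sup>+x. indicator {0..1} x * U (cis (2 * pi * x) *s v) \<partial>lborel)" for v
  proof (cases "norm v < \<rho>")
    case True
    define g where "g = (\<lambda>x. F (z + cis (2 * pi * x) *s v))"
    have in_S: "z + w *s v \<in> S" if "norm w \<le> 1" for w
    proof (rule subsetD[OF \<rho>(2)])
      have "norm w * norm v \<le> 1 * \<rho>" using that True by (intro mult_mono) auto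
      thus "z + w *s v \<in> cball z \<rho>" by (simp add: dist_norm norm_vector_scalar_mult_complex)
    qed
    hence "(\<lambda>w. F (z + w *s v)) holomorphic_on cball 0 1"
      by (intro holomorphic_vec_on_slice_holomorphic[OF F]) auto
    from mean_value_circle[OF this] have mv: "(g has_integral F z) {0..1}"
      by (simp add: g_def)
    have "continuous_on UNIV (\<lambda>x. z + cis (2 * pi * x) *s v)"
      by (intro continuous_intros continuous_on_compose2[OF linear_continuous_on[OF bounded_linear_vector_scalar_mult]]) auto
    hence cg: "continuous_on UNIV g"
      unfolding g_def
      by (rule continuous_on_compose2[OF holomorphic_vec_on_continuous[OF F(1)]]) (auto intro!: in_S)
    have ng: "((\<lambda>x. norm (g x)) has_integral integral {0..1} (\<lambda>x. norm (g x))) {0..1}"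
      by (intro integrable_integral integrable_continuous_interval continuous_intros continuous_on_subset[OF cg]) auto
    have "norm (F z) \<le> integral {0..1} (\<lambda>x. norm (g x))"
      using Henstock_Kurzweil_Integration.integral_norm_bound_integral[OF has_integral_integrable[OF mv] has_integral_integrable[OF ng]]
        integral_unique[OF mv] by simp
    moreover have "(\<integral>\<^sup>+x. indicator {0..1} x * ennreal (norm (g x)) \<partial>lborel) = ennreal (integral {0..1} (\<lambda>x. norm (g x)))"
      using nn_integral_has_integral_lebesgue[OF _ ng]
      by (simp add: ennreal_mult' ennreal_indicator)
    ultimately show ?thesis
      using True by (simp add: U_def g_def norm_vector_scalar_mult_complex ennreal_leI)
  qed auto
  have "ennreal (norm (F z) * (unit_ball_vol (DIM(complex ^ 'n)) * \<rho> ^ DIM(complex ^ 'n)))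
      = (\<integral>\<^sup>+v. ennreal (norm (F z)) * indicator (ball (0::complex ^ 'n) \<rho>) v \<partial>lborel)"
    using \<rho> by (simp add: nn_integral_cmult_indicator emeasure_ball ennreal_mult)
  also have "\<dots> \<le> (\<integral>\<^sup>+v. (\<integral>\<^sup>+x. indicator {0..1} x * U (cis (2 * pi * x) *s v) \<partial>lborel) \<partial>lborel)"
    by (rule nn_integral_mono) (rule pw)
  also have "\<dots> = (\<integral>\<^sup>+x. (\<integral>\<^sup>+v. indicator {0..1} x * U (cis (2 * pi * x) *s v) \<partial>lborel) \<partial>lborel)"
    by (rule lborel_pair.Fubini') measurable
  also have "\<dots> = (\<integral>\<^sup>+x. (\<integral>\<^sup>+v. U v \<partial>lborel) * indicator {0..1::real} x \<partial>lborel)"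
  proof (rule nn_integral_cong)
    fix x :: real
    have orth: "orthogonal_transformation (\<lambda>v :: complex ^ 'n. cis (2 * pi * x) *s v)"
      unfolding orthogonal_transformation
      by (auto simp: norm_vector_scalar_mult_complex linear_iff vec_eq_iff algebra_simps)
    have "(\<integral>\<^sup>+v. U (cis (2 * pi * x) *s v) \<partial>lborel) = (\<integral>\<^sup>+v. U v \<partial>lborel)"
      by (rule nn_integral_orthogonal_transformation[OF orth U])
    thus "(\<integral>\<^sup>+v. indicator {0..1} x * U (cis (2 * pi * x) *s v) \<partial>lborel) = (\<integral>\<^sup>+v. U v \<partial>lborel) * indicator {0..1::real} x"
      by (simp add: indicator_def)
  qed
  also have "\<dots> = (\<integral>\<^sup>+v. U v \<partial>lborel)"
    by (subst nn_integral_cmult_indicator) auto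
  also have "\<dots> = (\<integral>\<^sup>+v. indicator (ball z \<rho>) (z + v) * ennreal (norm (F (z + v))) \<partial>lborel)"
    by (intro nn_integral_cong) (simp add: U_def indicator_def dist_norm)
  also have "\<dots> = (\<integral>\<^sup>+w. indicator (ball z \<rho>) w * ennreal (norm (F w)) \<partial>lborel)"
    using \<rho> F
    by (intro nn_integral_lborel_shift borel_measurable_indicator_times_continuous continuous_intros
         continuous_on_subset[OF holomorphic_vec_on_continuous[OF F(1)]]) auto
  finally show ?thesis .
qed

text \<open>For $p \ge 1$ this replaces Jensen's inequality: $u \le l + l^{1-p} u^p$ holds for all $u \ge 0$ and
$l > 0$, and $l = |F(z)|/2$ lets the first term be absorbed by the left hand side of the case
$p = 1$.\<close>

lemma powr_norm_submean_ball_ge_1: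
  fixes z :: "complex ^ 'n"
  assumes p: "p > 0"
  assumes F: "holomorphic_vec_on F S" "open S" and \<rho>: "\<rho> > 0" "cball z \<rho> \<subseteq> S"
  assumes I: "(\<integral>\<^sup>+w. indicator (ball z \<rho>) w * ennreal (norm (F w) powr p) \<partial>lborel) = ennreal I" "I \<ge> 0"
  assumes p1: "p \<ge> 1"
  shows "norm (F z) powr p * \<rho> ^ DIM(complex ^ 'n) \<le> 2 powr p / unit_ball_vol (DIM(complex ^ 'n)) * I"
proof (cases "F z = 0")
  case True
  thus ?thesis using I p by simp
next
  case False
  define \<omega> where "\<omega> = unit_ball_vol (DIM(complex ^ 'n)) * \<rho> ^ DIM(complex ^ 'n)"
  have \<omega>: "\<omega> > 0" using \<rho> by (simp add: \<omega>_def)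
  define l where "l = norm (F z) / 2"
  have l: "l > 0" using False by (simp add: l_def)
  have cont: "continuous_on (ball z \<rho>) F"
    using \<rho>(2) ball_subset_cball by (blast intro: continuous_on_subset[OF holomorphic_vec_on_continuous[OF F(1)]])
  have meas: "(\<lambda>w. indicator (ball z \<rho>) w * ennreal (norm (F w) powr p)) \<in> borel_measurable borel"
    using p by (intro borel_measurable_indicator_times_continuous continuous_intros continuous_on_powr' cont) auto
  have pw: "norm (F w) \<le> l + l powr (1 - p) * norm (F w) powr p" for w
  proof (cases "norm (F w) \<le> l")
    case True
    thus ?thesis by (smt (verit) mult_nonneg_nonneg powr_ge_zero)
  next
    case False
    hence "norm (F w) powr (1 - p) \<le> l powr (1 - p)"
      using l p1 by (intro powr_mono2') auto
    hence "norm (F w) powr (1 - p) * norm (F w) powr p \<le> l powr (1 - p) * norm (F w) powr p"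
      by (intro mult_right_mono) auto
    thus ?thesis using l False by (simp flip: powr_add)
  qed
  have "ennreal (2 * l * \<omega>) \<le> (\<integral>\<^sup>+w. indicator (ball z \<rho>) w * ennreal (norm (F w)) \<partial>lborel)"
    using norm_submean_ball[OF F \<rho>] by (simp add: l_def \<omega>_def)
  also have "\<dots> \<le> (\<integral>\<^sup>+w. ennreal l * indicator (ball z \<rho>) w + ennreal (l powr (1 - p)) *
      (indicator (ball z \<rho>) w * ennreal (norm (F w) powr p)) \<partial>lborel)"
  proof (rule nn_integral_mono)
    fix w
    have "ennreal (norm (F w)) \<le> ennreal l + ennreal (l powr (1 - p)) * ennreal (norm (F w) powr p)"
      using pw[of w] l by (simp add: ennreal_leI flip: ennreal_mult ennreal_plus)
    thus "indicator (ball z \<rho>) w * ennreal (norm (F w)) \<le> ennreal l * indicator (ball z \<rho>) w +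
       ennreal (l powr (1 - p)) * (indicator (ball z \<rho>) w * ennreal (norm (F w) powr p))"
      by (simp add: indicator_def)
  qed
  also have "\<dots> = ennreal l * emeasure lborel (ball z \<rho>) + ennreal (l powr (1 - p)) * ennreal I"
  proof -
    have "(\<lambda>w. ennreal l * indicator (ball z \<rho>) w) \<in> borel_measurable borel"
      by (intro borel_measurable_times_ennreal borel_measurable_const borel_measurable_indicator) simp
    thus ?thesis
      using meas by (subst nn_integral_add) (auto simp: nn_integral_cmult nn_integral_cmult_indicator I(1))
  qed
  also have "\<dots> = ennreal (l * \<omega> + l powr (1 - p) * I)"
    using \<rho> l I(2) \<omega> by (simp add: emeasure_ball \<omega>_def ennreal_mult ennreal_plus)
  finally have "2 * l * \<omega> \<le> l * \<omega> + l powr (1 - p) * I"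
    using l \<omega> I(2) by (subst (asm) ennreal_le_iff) (auto simp: mult.commute)
  hence "l * \<omega> \<le> l powr (1 - p) * I" by linarith
  hence "l powr (p - 1) * (l * \<omega>) \<le> l powr (p - 1) * (l powr (1 - p) * I)"
    by (intro mult_left_mono) auto
  moreover have "l powr (p - 1) * l = l powr p" "l powr (p - 1) * l powr (1 - p) = 1"
    using l by (simp_all add: powr_diff flip: powr_add)
  ultimately have "l powr p * \<omega> \<le> I"
    by (simp flip: mult.assoc)
  moreover have "norm (F z) powr p = 2 powr p * l powr p"
    using l by (simp add: l_def powr_divide)
  moreover have "2 powr p * (l powr p * \<omega>) \<le> 2 powr p * I"
    using calculation(1) by (intro mult_left_mono) auto
  ultimately show ?thesis
    by (simp add: \<omega>_def field_simps)
qed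

text \<open>For $p \le 1$ the argument is that of Hardy, Littlewood and Fefferman, Stein.  Let $M$ be the maximum
of $(\rho - |x - z|)^{N/p} |F(x)|$, attained at some $x$.  On a ball around $x$ that stays away
from the boundary, maximality bounds $|F|$, so $|F| = |F|^{1-p} |F|^p$ is at most a constant times
$|F|^p$, and the case $p = 1$ at $x$ becomes $M \le C M^{1-p} I$.  The exponent $N/p$ is the one for
which all powers of the radius cancel.\<close>

lemma powr_norm_submean_ball_le_1:
  fixes z :: "complex ^ 'n"
  assumes p: "p > 0"
  assumes F: "holomorphic_vec_on F S" "open S" and \<rho>: "\<rho> > 0" "cball z \<rho> \<subseteq> S"
  assumes I: "(\<integral>\<^sup>+w. indicator (ball z \<rho>) w * ennreal (norm (F w) powr p) \<partial>lborel) = ennreal I" "I \<ge> 0"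
  assumes p1: "p \<le> 1"
  shows "norm (F z) powr p * \<rho> ^ DIM(complex ^ 'n)
           \<le> 2 powr (DIM(complex ^ 'n) / p) / unit_ball_vol (DIM(complex ^ 'n)) * I"
proof -
  define N where "N = DIM(complex ^ 'n)"
  define a where "a = real N / p"
  have a: "a > 0" using p by (simp add: a_def N_def)
  define \<omega> where "\<omega> = unit_ball_vol N"
  have \<omega>: "\<omega> > 0" by (simp add: \<omega>_def)
  have ap: "(x powr a) powr p = x ^ N" if "x > 0" for x :: real
    using that p by (simp add: powr_powr a_def powr_realpow)
  define \<phi> where "\<phi> = (\<lambda>x. (\<rho> - dist z x) powr a * norm (F x))"
  have "continuous_on (cball z \<rho>) \<phi>"
    unfolding \<phi>_def using a
    by (intro continuous_intros continuous_on_powr' continuous_on_subset[OF holomorphic_vec_on_continuous[OF F(1)] \<rho>(2)]) auto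
  moreover have "compact (cball z \<rho>)" "cball z \<rho> \<noteq> {}" using \<rho> by auto
  ultimately obtain x where x: "x \<in> cball z \<rho>" and max: "\<And>y. y \<in> cball z \<rho> \<Longrightarrow> \<phi> y \<le> \<phi> x"
    using continuous_attains_sup by metis
  define M where "M = \<phi> x"
  have zM: "\<rho> powr a * norm (F z) \<le> M"
    using max[of z] \<rho> by (simp add: M_def \<phi>_def)
  have zMp: "norm (F z) powr p * \<rho> ^ N \<le> M powr p"
  proof -
    have "(\<rho> powr a * norm (F z)) powr p \<le> M powr p"
      using zM p \<rho> by (intro powr_mono2) auto
    thus ?thesis using \<rho> ap[of \<rho>] by (simp add: powr_mult mult.commute)
  qed
  have "M powr p \<le> 2 powr a / \<omega> * I"
  proof (cases "M = 0")
    case True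
    thus ?thesis using \<omega> I p by simp
  next
    case False
    define \<delta> where "\<delta> = (\<rho> - dist z x) / 2"
    have \<delta>: "\<delta> > 0" using False x by (auto simp: M_def \<phi>_def \<delta>_def)
    define K where "K = M / \<delta> powr a"
    have M: "M > 0" using False by (auto simp: M_def \<phi>_def less_le)
    have K: "K > 0" using M \<delta> by (simp add: K_def)
    have sub: "cball x \<delta> \<subseteq> ball z \<rho>"
      using \<delta> by (auto simp: \<delta>_def cball_subset_ball_iff dist_commute field_simps)
    have Fy: "norm (F y) \<le> K powr (1 - p) * norm (F y) powr p" if y: "y \<in> ball x \<delta>" for y
    proof (cases "F y = 0")
      case Fy0: False
      have yd: "\<rho> - dist z y \<ge> \<delta>"
        using y dist_triangle[of z y x] by (simp add: \<delta>_def field_simps)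
      have "\<delta> powr a * norm (F y) \<le> (\<rho> - dist z y) powr a * norm (F y)"
        using yd \<delta> a by (intro mult_right_mono powr_mono2) auto
      also have "\<dots> \<le> M"
        using max[of y] yd \<delta> by (simp add: M_def \<phi>_def)
      finally have "norm (F y) \<le> K"
        using \<delta> by (simp add: K_def field_simps)
      hence "norm (F y) powr (1 - p) \<le> K powr (1 - p)"
        using p1 by (intro powr_mono2) auto
      hence "norm (F y) powr (1 - p) * norm (F y) powr p \<le> K powr (1 - p) * norm (F y) powr p"
        by (intro mult_right_mono) auto
      thus ?thesis using Fy0 by (simp flip: powr_add)
    qed (use p in auto)
    have "ennreal (norm (F x) * (\<omega> * \<delta> ^ N)) \<le> (\<integral>\<^sup>+w. indicator (ball x \<delta>) w * ennreal (norm (F w)) \<partial>lborel)"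
      unfolding \<omega>_def N_def
    proof (rule norm_submean_ball[OF F \<delta>])
      show "cball x \<delta> \<subseteq> S" using sub \<rho>(2) ball_subset_cball[of z \<rho>] by blast
    qed
    also have "\<dots> \<le> (\<integral>\<^sup>+w. ennreal (K powr (1 - p)) * (indicator (ball z \<rho>) w * ennreal (norm (F w) powr p)) \<partial>lborel)"
    proof (rule nn_integral_mono)
      fix w
      show "indicator (ball x \<delta>) w * ennreal (norm (F w)) \<le> ennreal (K powr (1 - p)) * (indicator (ball z \<rho>) w * ennreal (norm (F w) powr p))"
      proof (cases "w \<in> ball x \<delta>")
        case True
        hence "w \<in> ball z \<rho>" using sub ball_subset_cball by blast
        thus ?thesis using True Fy[OF True] by (simp add: ennreal_leI flip: ennreal_mult)
      qed auto
    qed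
    also have "\<dots> = ennreal (K powr (1 - p)) * ennreal I"
    proof (subst nn_integral_cmult)
      have "continuous_on (ball z \<rho>) F"
        using \<rho>(2) ball_subset_cball by (blast intro: continuous_on_subset[OF holomorphic_vec_on_continuous[OF F(1)]])
      thus "(\<lambda>w. indicator (ball z \<rho>) w * ennreal (norm (F w) powr p)) \<in> borel_measurable lborel"
        using p borel_measurable_indicator_times_continuous[of "ball z \<rho>" "\<lambda>w. norm (F w) powr p"]
        by (simp add: continuous_intros continuous_on_powr')
    qed (simp add: I(1))
    also have "\<dots> = ennreal (K powr (1 - p) * I)"
      using I by (simp add: ennreal_mult)
    finally have le: "norm (F x) * (\<omega> * \<delta> ^ N) \<le> K powr (1 - p) * I"
      using I by (subst (asm) ennreal_le_iff) auto
    have d2: "\<rho> - dist z x = 2 * \<delta>" by (simp add: \<delta>_def)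
    have "M = (2 * \<delta>) powr a * norm (F x)"
      by (simp only: M_def \<phi>_def d2)
    hence Fx: "norm (F x) * 2 powr a = K"
      using \<delta> by (simp add: K_def powr_mult field_simps)
    have "K powr (p - 1) * (K * (\<omega> * \<delta> ^ N)) = K powr (p - 1) * 2 powr a * (norm (F x) * (\<omega> * \<delta> ^ N))"
      by (simp flip: Fx)
    also have "\<dots> \<le> K powr (p - 1) * 2 powr a * (K powr (1 - p) * I)"
      by (intro mult_left_mono le) auto
    also have "\<dots> = 2 powr a * I * (K powr (p - 1) * K powr (1 - p))"
      by (simp add: mult_ac)
    also have "K powr (p - 1) * K powr (1 - p) = 1"
      using K by (simp flip: powr_add)
    also have "K powr (p - 1) * (K * (\<omega> * \<delta> ^ N)) = K powr p * \<delta> ^ N * \<omega>"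
      using K by (simp add: powr_diff)
    also have "K powr p * \<delta> ^ N = M powr p"
      using \<delta> M ap[of \<delta>] by (simp add: K_def powr_divide)
    finally show ?thesis using \<omega> by (simp add: field_simps)
  qed
  with zMp show ?thesis
    by (simp add: N_def a_def \<omega>_def)
qed

text \<open>The constant depends on the exponent and the dimension only; this uniformity is what makes
integration over $z$ possible.\<close>

theorem powr_norm_submean_ball:
  fixes p :: real
  assumes p: "p > 0"
  shows "\<exists>C>0. \<forall>F S (z :: complex ^ 'n) \<rho>. holomorphic_vec_on F S \<longrightarrow> open S \<longrightarrow> \<rho> > 0 \<longrightarrow> cball z \<rho> \<subseteq> S \<longrightarrow>
     ennreal (norm (F z) powr p * \<rho> ^ DIM(complex ^ 'n))
       \<le> ennreal C * (\<integral>\<^sup>+w. indicator (ball z \<rho>) w * ennreal (norm (F w) powr p) \<partial>lborel)"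
proof -
  define C where "C = (if p \<ge> 1 then 2 powr p else 2 powr (DIM(complex ^ 'n) / p)) / unit_ball_vol (DIM(complex ^ 'n))"
  have C: "C > 0" by (simp add: C_def)
  have "ennreal (norm (F z) powr p * \<rho> ^ DIM(complex ^ 'n))
       \<le> ennreal C * (\<integral>\<^sup>+w. indicator (ball z \<rho>) w * ennreal (norm (F w) powr p) \<partial>lborel)"
    if A: "holomorphic_vec_on F S" "open S" "\<rho> > 0" "cball z \<rho> \<subseteq> S" for F S \<rho> and z :: "complex ^ 'n"
  proof (cases "(\<integral>\<^sup>+w. indicator (ball z \<rho>) w * ennreal (norm (F w) powr p) \<partial>lborel)")
    case (real I)
    have "norm (F z) powr p * \<rho> ^ DIM(complex ^ 'n) \<le> C * I"
      using powr_norm_submean_ball_ge_1[OF p A real(2,1)] powr_norm_submean_ball_le_1[OF p A real(2,1)]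
      by (simp add: C_def split: if_splits)
    thus ?thesis
      using C by (simp add: real ennreal_leI flip: ennreal_mult)
  qed (use C in \<open>simp add: ennreal_mult_top\<close>)
  thus ?thesis using C by blast
qed

text \<open>Cauchy's formula on a circle of radius $\rho/2$ around $z$ bounds $\rho |\partial_k F(z)|/2$ by values
of $F$ on the circle.  Each of these is controlled by the integral over a ball of radius $\rho/2$
contained in the one around $z$.\<close>

lemma powr_norm_partial_deriv_submean_ball:
  fixes p :: real
  assumes p: "p > 0"
  shows "\<exists>C>0. \<forall>F S (z :: complex ^ 'n) \<rho> k. holomorphic_vec_on F S \<longrightarrow> open S \<longrightarrow> \<rho> > 0 \<longrightarrow> cball z \<rho> \<subseteq> S \<longrightarrow>
     ennreal (norm (partial_deriv k F z) powr p * \<rho> powr (p + DIM(complex ^ 'n)))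
       \<le> ennreal C * (\<integral>\<^sup>+w. indicator (ball z \<rho>) w * ennreal (norm (F w) powr p) \<partial>lborel)"
proof -
  let ?N = "DIM(complex ^ 'n)"
  obtain C where C: "C > 0" and sm: "\<And>F S (z :: complex ^ 'n) \<rho>. holomorphic_vec_on F S \<Longrightarrow> open S \<Longrightarrow> \<rho> > 0 \<Longrightarrow> cball z \<rho> \<subseteq> S \<Longrightarrow>
     ennreal (norm (F z) powr p * \<rho> ^ ?N)
       \<le> ennreal C * (\<integral>\<^sup>+w. indicator (ball z \<rho>) w * ennreal (norm (F w) powr p) \<partial>lborel)"
    using powr_norm_submean_ball[OF p, where 'n = 'n] by blast
  define C' where "C' = 2 powr (p + ?N) * C"
  have C': "C' > 0" using C by (simp add: C'_def)
  have "ennreal (norm (partial_deriv k F z) powr p * \<rho> powr (p + ?N))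
       \<le> ennreal C' * (\<integral>\<^sup>+w. indicator (ball z \<rho>) w * ennreal (norm (F w) powr p) \<partial>lborel)"
    if A: "holomorphic_vec_on F S" "open S" "\<rho> > 0" "cball z \<rho> \<subseteq> S" for F S \<rho> k and z :: "complex ^ 'n"
  proof (cases "(\<integral>\<^sup>+w. indicator (ball z \<rho>) w * ennreal (norm (F w) powr p) \<partial>lborel)")
    case (real I)
    define r where "r = \<rho> / 2"
    have r: "r > 0" using A by (simp add: r_def)
    have rS: "cball z r \<subseteq> S" using A by (auto simp: r_def)
    define B where "B = (C * I / r ^ ?N) powr (1 / p)"
    have "norm (F (z + axis k (of_real r * cis (2 * pi * x)))) \<le> B" for x
    proof -
      define y where "y = z + axis k (of_real r * cis (2 * pi * x))"
      have dy: "dist y z = r" using r by (simp add: y_def dist_norm norm_mult)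
      have ySub: "cball y r \<subseteq> cball z \<rho>" "ball y r \<subseteq> ball z \<rho>"
        by (auto simp: cball_subset_cball_iff ball_subset_ball_iff dy r_def)
      have "ennreal (norm (F y) powr p * r ^ ?N)
          \<le> ennreal C * (\<integral>\<^sup>+w. indicator (ball y r) w * ennreal (norm (F w) powr p) \<partial>lborel)"
        using ySub A r by (intro sm[of F S]) auto
      also have "\<dots> \<le> ennreal C * ennreal I"
        unfolding real(2)[symmetric] using ySub(2)
        by (intro mult_left_mono nn_integral_mono mult_right_mono) (auto simp: indicator_def)
      also have "\<dots> = ennreal (C * I)" using C real by (simp add: ennreal_mult)
      finally have "norm (F y) powr p * r ^ ?N \<le> C * I"
        using C real by (subst (asm) ennreal_le_iff) auto
      hence "norm (F y) powr p \<le> C * I / r ^ ?N"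
        using r by (simp add: field_simps)
      hence "(norm (F y) powr p) powr (1 / p) \<le> B"
        unfolding B_def using p by (intro powr_mono2) auto
      thus ?thesis using p by (simp add: powr_powr y_def)
    qed
    hence "norm (of_real r * partial_deriv k F z) \<le> B * measure lborel (cbox 0 (1::real))"
      using partial_deriv_circle[OF A(1,2) r rS, of k]
      by (intro has_integral_bound[where f = "\<lambda>x. F (z + axis k (of_real r * cis (2 * pi * x))) / cis (2 * pi * x)"])
         (auto simp: B_def norm_divide)
    hence "r * norm (partial_deriv k F z) \<le> B"
      using r by (simp add: norm_mult)
    hence "(r * norm (partial_deriv k F z)) powr p \<le> B powr p"
      using r p by (intro powr_mono2) auto
    also have "B powr p = C * I / r ^ ?N"
      using p C r real by (simp add: B_def powr_powr)
    finally have "norm (partial_deriv k F z) powr p * (r powr p * r ^ ?N) \<le> C * I"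
      using r by (simp add: powr_mult field_simps)
    moreover have "\<rho> powr (p + ?N) = 2 powr (p + ?N) * (r powr p * r ^ ?N)"
    proof -
      have "\<rho> powr (p + ?N) = (2 * r) powr (p + ?N)" by (simp add: r_def)
      also have "\<dots> = 2 powr (p + ?N) * (r powr p * r powr real ?N)"
        using r by (simp only: powr_mult powr_add mult_ac)
      also have "r powr real ?N = r ^ ?N" using r by (rule powr_realpow)
      finally show ?thesis .
    qed
    ultimately have "norm (partial_deriv k F z) powr p * \<rho> powr (p + ?N) \<le> C' * I"
      by (simp add: C'_def mult_ac)
    thus ?thesis
      using C' by (simp add: real ennreal_leI flip: ennreal_mult)
  qed (use C' in \<open>simp add: ennreal_mult_top\<close>)
  thus ?thesis using C' by blast
qed

section \<open>Weighted integrals of derivatives\<close>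

text \<open>The weight is a power of $1 - |w|$ and not of $1 - |w|^2$ because the distance to the sphere is what
the geometric estimates see; the two give the same classes (\<open>weighted_integral_finite_iff\<close>).\<close>

definition weighted_integral :: "real \<Rightarrow> real \<Rightarrow> (complex ^ 'n \<Rightarrow> complex) \<Rightarrow> ennreal" where
  "weighted_integral p \<beta> F =
     (\<integral>\<^sup>+w. indicator (ball 0 1) w * ennreal ((1 - norm w) powr \<beta>) * ennreal (norm (F w) powr p) \<partial>lborel)"

lemma continuous_on_norm_powr:
  fixes F :: "'a::topological_space \<Rightarrow> 'b::real_normed_vector"
  assumes "continuous_on S F" "p > 0"
  shows "continuous_on S (\<lambda>w. norm (F w) powr p)"
  using assms by (intro continuous_on_powr' continuous_intros) auto

lemma weighted_integral_partial_deriv_le: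
  fixes p \<beta> :: real
  assumes p: "p > 0"
  shows "\<exists>C\<ge>0. \<forall>F k. holomorphic_vec_on F (ball (0::complex ^ 'n) 1) \<longrightarrow>
     weighted_integral p (\<beta> + p) (partial_deriv k F) \<le> ennreal C * weighted_integral p \<beta> F"
proof -
  let ?N = "DIM(complex ^ 'n)"
  obtain C1 where C1: "C1 > 0" and sm: "\<And>F S (z :: complex ^ 'n) \<rho> k. holomorphic_vec_on F S \<Longrightarrow> open S \<Longrightarrow> \<rho> > 0 \<Longrightarrow> cball z \<rho> \<subseteq> S \<Longrightarrow>
     ennreal (norm (partial_deriv k F z) powr p * \<rho> powr (p + ?N))
       \<le> ennreal C1 * (\<integral>\<^sup>+w. indicator (ball z \<rho>) w * ennreal (norm (F w) powr p) \<partial>lborel)"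
    using powr_norm_partial_deriv_submean_ball[OF p, where 'n = 'n] by blast
  obtain C2 where C2: "C2 \<ge> 0" and loc: "\<And>g. g \<in> borel_measurable borel \<Longrightarrow>
     (\<integral>\<^sup>+z. (\<integral>\<^sup>+w. ennreal ((1 - norm z) powr (\<beta> - ?N)) * g w
          * indicator {w. within_reach 1 z w} w \<partial>lborel) \<partial>lborel)
     \<le> ennreal C2 * (\<integral>\<^sup>+w. indicator (ball 0 1) w * ennreal ((1 - norm w) powr \<beta>) * g (w::complex ^ 'n) \<partial>lborel)"
    using nn_integral_local_average_le[of 1 \<beta>, where 'a = "complex ^ 'n"] by blast
  define C where "C = 2 powr (p + ?N) * C1"
  have C: "C \<ge> 0" using C1 by (simp add: C_def)
  have "weighted_integral p (\<beta> + p) (partial_deriv k F) \<le> ennreal (C * C2) * weighted_integral p \<beta> F"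
    if F: "holomorphic_vec_on F (ball (0::complex ^ 'n) 1)" for F k
  proof -
    define g where "g = (\<lambda>w. indicator (ball 0 1) w * ennreal (norm (F w) powr p))"
    have g [measurable]: "g \<in> borel_measurable borel"
      unfolding g_def using p
      by (intro borel_measurable_indicator_times_continuous continuous_on_norm_powr holomorphic_vec_on_continuous[OF F]) auto
    have "weighted_integral p (\<beta> + p) (partial_deriv k F) \<le>
      (\<integral>\<^sup>+z. ennreal C * (\<integral>\<^sup>+w. ennreal ((1 - norm z) powr (\<beta> - ?N)) * g w
          * indicator {w. within_reach 1 z w} w \<partial>lborel) \<partial>lborel)"
      unfolding weighted_integral_def
    proof (rule nn_integral_mono)
      fix z :: "complex ^ 'n"
      show "indicator (ball 0 1) z * ennreal ((1 - norm z) powr (\<beta> + p)) * ennreal (norm (partial_deriv k F z) powr p)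
         \<le> ennreal C * (\<integral>\<^sup>+w. ennreal ((1 - norm z) powr (\<beta> - ?N)) * g w * indicator {w. within_reach 1 z w} w \<partial>lborel)"
      proof (cases "norm z < 1")
        case True
        define d where "d = 1 - norm z"
        have d: "d > 0" using True by (simp add: d_def)
        have near: "2 * norm w \<le> norm z + 1" if "dist z w \<le> d / 2" for w
          using that norm_triangle_ineq2[of w z] d_def by (simp add: dist_norm norm_minus_commute)
        have sub: "cball z (d / 2) \<subseteq> ball 0 1"
        proof
          fix w assume "w \<in> cball z (d / 2)"
          hence "2 * norm w \<le> norm z + 1" by (intro near) auto
          hence "norm w < 1" using d d_def by linarith
          thus "w \<in> ball 0 1" by simp
        qed
        have "(1 - norm z) powr (\<beta> + p) * norm (partial_deriv k F z) powr p
            = 2 powr (p + ?N) * d powr (\<beta> - ?N) * (norm (partial_deriv k F z) powr p * (d / 2) powr (p + ?N))"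
          using d by (simp add: powr_divide d_def flip: powr_add)
        hence "ennreal ((1 - norm z) powr (\<beta> + p)) * ennreal (norm (partial_deriv k F z) powr p)
            = ennreal (2 powr (p + ?N) * d powr (\<beta> - ?N)) * ennreal (norm (partial_deriv k F z) powr p * (d / 2) powr (p + ?N))"
          by (simp flip: ennreal_mult)
        also have "\<dots> \<le> ennreal (2 powr (p + ?N) * d powr (\<beta> - ?N)) *
            (ennreal C1 * (\<integral>\<^sup>+w. indicator (ball z (d / 2)) w * ennreal (norm (F w) powr p) \<partial>lborel))"
          using d by (intro mult_left_mono sm[OF F _ _ sub]) auto
        also have "\<dots> \<le> ennreal (2 powr (p + ?N) * d powr (\<beta> - ?N)) *
            (ennreal C1 * (\<integral>\<^sup>+w. g w * indicator {w. within_reach 1 z w} w \<partial>lborel))"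
        proof (intro mult_left_mono nn_integral_mono)
          fix w :: "complex ^ 'n"
          show "indicator (ball z (d / 2)) w * ennreal (norm (F w) powr p) \<le> g w * indicator {w. within_reach 1 z w} w"
          proof (cases "w \<in> ball z (d / 2)")
            case w: True
            hence "2 * norm w \<le> norm z + 1" by (intro near) auto
            hence "within_reach 1 z w" "w \<in> ball 0 1"
              using w d True by (auto simp: within_reach_def d_def)
            thus ?thesis using w by (simp add: g_def)
          qed auto
        qed auto
        also have "\<dots> = ennreal C * (ennreal (d powr (\<beta> - ?N)) * (\<integral>\<^sup>+w. g w * indicator {w. within_reach 1 z w} w \<partial>lborel))"
          using C1 by (simp add: C_def ennreal_mult mult_ac)
        also have "ennreal (d powr (\<beta> - ?N)) * (\<integral>\<^sup>+w. g w * indicator {w. within_reach 1 z w} w \<partial>lborel)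
            = (\<integral>\<^sup>+w. ennreal (d powr (\<beta> - ?N)) * g w * indicator {w. within_reach 1 z w} w \<partial>lborel)"
          by (simp add: nn_integral_cmult mult.assoc)
        finally show ?thesis using True by (simp add: d_def)
      qed auto
    qed
    also have "\<dots> = ennreal C * (\<integral>\<^sup>+z. (\<integral>\<^sup>+w. ennreal ((1 - norm z) powr (\<beta> - ?N)) * g w
          * indicator {w. within_reach 1 z w} w \<partial>lborel) \<partial>lborel)"
      by (rule nn_integral_cmult) measurable
    also have "\<dots> \<le> ennreal C * (ennreal C2 * (\<integral>\<^sup>+w. indicator (ball 0 1) w * ennreal ((1 - norm w) powr \<beta>) * g w \<partial>lborel))"
      by (intro mult_left_mono loc g) auto
    also have "(\<integral>\<^sup>+w. indicator (ball 0 1) w * ennreal ((1 - norm w) powr \<beta>) * g w \<partial>lborel) = weighted_integral p \<beta> F"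
      unfolding weighted_integral_def g_def by (intro nn_integral_cong) (simp add: indicator_def)
    finally show ?thesis
      using C C2 by (simp add: ennreal_mult mult_ac)
  qed
  thus ?thesis using C C2 by (intro exI[of _ "C * C2"]) auto
qed

text \<open>The factor $s^c$ is an integrating factor: it turns $RF + cF$ into a derivative along the ray
through $z$.\<close>

lemma radial_power_has_vector_derivative:
  fixes z :: "complex ^ 'n"
  assumes F: "holomorphic_vec_on F S" "open S" and s: "s > 0" "s *\<^sub>R z \<in> S"
  shows "((\<lambda>s. of_real s ^ c * F (s *\<^sub>R z)) has_vector_derivative
           of_real (s ^ c / s) * (radial_deriv F (s *\<^sub>R z) + of_nat c * F (s *\<^sub>R z))) (at s)"
proof -
  define D where "D = (\<lambda>v. \<Sum>k\<in>UNIV. v $ k * partial_deriv k F (s *\<^sub>R z))"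
  have "(F has_derivative D) (at (s *\<^sub>R z))"
    unfolding D_def by (rule holomorphic_vec_on_has_derivative[OF F s(2)])
  hence "((\<lambda>s. F (s *\<^sub>R z)) has_derivative (\<lambda>h. D (h *\<^sub>R z))) (at s)"
    by (intro has_derivative_compose[where g = F and f = "\<lambda>s. s *\<^sub>R z"]) (auto intro!: derivative_eq_intros)
  moreover have "D (h *\<^sub>R z) = h *\<^sub>R D z" for h
    by (simp add: D_def scaleR_sum_right)
  ultimately have 1: "((\<lambda>s. F (s *\<^sub>R z)) has_vector_derivative D z) (at s)"
    by (simp add: has_vector_derivative_def)
  have 2: "((\<lambda>s. of_real s ^ c :: complex) has_vector_derivative of_nat c * of_real (s ^ c / s)) (at s)"
  proof -
    have "((\<lambda>s. of_real (s ^ c) :: complex) has_vector_derivative of_real (of_nat c * (s ^ c / s))) (at s)"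
      by (intro has_vector_derivative_of_real)
         (use s in \<open>auto intro!: derivative_eq_intros simp flip: has_real_derivative_iff_has_vector_derivative\<close>,
          cases c; simp)
    thus ?thesis by simp
  qed
  have "radial_deriv F (s *\<^sub>R z) = of_real s * D z"
  proof -
    have "(s *\<^sub>R z) $ k = of_real s * z $ k" for k
      by (simp only: vector_scaleR_component scaleR_conv_of_real[of s "z $ k"])
    thus ?thesis
      by (simp only: radial_deriv_def D_def sum_distrib_left mult.assoc)
  qed
  hence "of_real (s ^ c / s) * (radial_deriv F (s *\<^sub>R z) + of_nat c * F (s *\<^sub>R z))
      = of_real s ^ c * D z + of_nat c * of_real (s ^ c / s) * F (s *\<^sub>R z)"
    using s by (simp add: algebra_simps)
  thus ?thesis
    using has_vector_derivative_mult[OF 2 1] by simp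
qed

text \<open>On the segment from $tz$ to $z$ the derivative of $s^c F(sz)$ is at most twice the maximum of
$|RF + cF|$, since $s \ge 1/2$, and the length $1 - t$ is at most $2L\delta(z)$.  At each point of the
segment the sub-mean value property on a ball of radius $\delta(z)/2$ applies.  All these balls lie
in one set of points within reach of $z$, so the bound does not depend on $t$.\<close>

lemma radial_increment_le:
  fixes p :: real
  assumes p: "p > 0"
  shows "\<exists>C>0. \<forall>F c L (z :: complex ^ 'n) t. holomorphic_vec_on F (ball 0 1) \<longrightarrow> L \<ge> 1 \<longrightarrow> norm z < 1 \<longrightarrow>
      L * (1 - norm z) \<le> 1/4 \<longrightarrow> L * (1 - norm z) \<le> 1 - t \<longrightarrow> 1 - t \<le> 2 * L * (1 - norm z) \<longrightarrow>
      ennreal (norm (F z - of_real t ^ c * F (t *\<^sub>R z)) powr p)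
        \<le> ennreal (C * L powr p * (1 - norm z) powr (p - DIM(complex ^ 'n))) *
           (\<integral>\<^sup>+w. indicator (ball 0 1) w * ennreal (norm (radial_deriv F w + of_nat c * F w) powr p)
              * indicator {w. within_reach (2 * L + 1) z w} w \<partial>lborel)"
proof -
  let ?N = "DIM(complex ^ 'n)"
  obtain C1 where C1: "C1 > 0" and sm: "\<And>F S (z :: complex ^ 'n) \<rho> k. holomorphic_vec_on F S \<Longrightarrow> open S \<Longrightarrow> \<rho> > 0 \<Longrightarrow> cball z \<rho> \<subseteq> S \<Longrightarrow>
     ennreal (norm (F z) powr p * \<rho> ^ ?N)
       \<le> ennreal C1 * (\<integral>\<^sup>+w. indicator (ball z \<rho>) w * ennreal (norm (F w) powr p) \<partial>lborel)"
    using powr_norm_submean_ball[OF p, where 'n = 'n] by blast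
  define C where "C = 4 powr p * 2 ^ ?N * C1"
  have C: "C > 0" using C1 by (simp add: C_def)
  have "ennreal (norm (F z - of_real t ^ c * F (t *\<^sub>R z)) powr p)
        \<le> ennreal (C * L powr p * (1 - norm z) powr (p - ?N)) *
           (\<integral>\<^sup>+w. indicator (ball 0 1) w * ennreal (norm (radial_deriv F w + of_nat c * F w) powr p)
              * indicator {w. within_reach (2 * L + 1) z w} w \<partial>lborel)"
    if F: "holomorphic_vec_on F (ball 0 1)" and L: "L \<ge> 1" and z: "norm z < 1" "L * (1 - norm z) \<le> 1/4"
      and t: "L * (1 - norm z) \<le> 1 - t" "1 - t \<le> 2 * L * (1 - norm z)"
    for F L t c and z :: "complex ^ 'n"
  proof -
    define G where "G = (\<lambda>w. radial_deriv F w + of_nat c * F w)"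
    have G: "holomorphic_vec_on G (ball 0 1)"
      unfolding G_def using F by (intro holomorphic_vec_on_radial) auto
    define d where "d = 1 - norm z"
    have d: "d > 0" "L * d \<le> 1/4" using z by (auto simp: d_def)
    have Ld: "L * d > 0" using L d by auto
    have t': "1/2 \<le> t" "t \<le> 1" "1 - t \<le> 2 * L * d" using t d Ld unfolding d_def[symmetric] by linarith+
    define Q where "Q = (\<integral>\<^sup>+w. indicator (ball 0 1) w * ennreal (norm (G w) powr p)
              * indicator {w. within_reach (2 * L + 1) z w} w \<partial>lborel)"
    have "ennreal (norm (F z - of_real t ^ c * F (t *\<^sub>R z)) powr p) \<le> ennreal (C * L powr p * d powr (p - ?N)) * Q"
    proof (cases Q)
      case (real q)
      define B where "B = (C1 * q / (d / 2) ^ ?N) powr (1 / p)"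
      have GB: "norm (G (s *\<^sub>R z)) \<le> B" if s: "s \<in> {t..1}" for s
      proof -
        have s0: "0 \<le> s" "s \<le> 1" using s t' by auto
        have sz: "norm (s *\<^sub>R z) \<le> norm z"
          using s0 by (simp add: mult_left_le_one_le)
        have near: "2 * norm w \<le> norm z + 1" if "dist (s *\<^sub>R z) w \<le> d / 2" for w
          using that sz norm_triangle_ineq2[of w "s *\<^sub>R z"] d_def by (simp add: dist_norm norm_minus_commute)
        have sub: "cball (s *\<^sub>R z) (d / 2) \<subseteq> ball 0 1"
        proof
          fix w assume "w \<in> cball (s *\<^sub>R z) (d / 2)"
          hence "2 * norm w \<le> norm z + 1" by (intro near) auto
          hence "norm w < 1" using d d_def by linarith
          thus "w \<in> ball 0 1" by simp
        qed
        have "ennreal (norm (G (s *\<^sub>R z)) powr p * (d / 2) ^ ?N)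
            \<le> ennreal C1 * (\<integral>\<^sup>+w. indicator (ball (s *\<^sub>R z) (d / 2)) w * ennreal (norm (G w) powr p) \<partial>lborel)"
          using d by (intro sm[OF G _ _ sub]) auto
        also have "\<dots> \<le> ennreal C1 * Q"
          unfolding Q_def
        proof (intro mult_left_mono nn_integral_mono)
          fix w :: "complex ^ 'n"
          show "indicator (ball (s *\<^sub>R z) (d / 2)) w * ennreal (norm (G w) powr p)
            \<le> indicator (ball 0 1) w * ennreal (norm (G w) powr p) * indicator {w. within_reach (2 * L + 1) z w} w"
          proof (cases "w \<in> ball (s *\<^sub>R z) (d / 2)")
            case w: True
            have nw: "2 * norm w \<le> norm z + 1" using w by (intro near) auto
            have "dist z w \<le> dist z (s *\<^sub>R z) + dist (s *\<^sub>R z) w" by (rule dist_triangle)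
            also have "z - s *\<^sub>R z = (1 - s) *\<^sub>R z" by (simp add: algebra_simps)
            hence "dist z (s *\<^sub>R z) = (1 - s) * norm z" using s0 by (simp add: dist_norm)
            also have "(1 - s) * norm z \<le> (1 - s) * 1" using s0 z by (intro mult_left_mono) auto
            also have "(1 - s) * 1 + dist (s *\<^sub>R z) w \<le> 2 * L * d + d / 2"
              using w s t' by auto
            finally have "dist z w \<le> (2 * L + 1) * d" using d by (simp add: algebra_simps)
            hence "within_reach (2 * L + 1) z w" "w \<in> ball 0 1"
              using nw d z by (auto simp: within_reach_def d_def)
            thus ?thesis using w by simp
          qed auto
        qed auto
        also have "\<dots> = ennreal (C1 * q)" using C1 real by (simp add: ennreal_mult)
        finally have "norm (G (s *\<^sub>R z)) powr p * (d / 2) ^ ?N \<le> C1 * q"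
          using C1 real by (subst (asm) ennreal_le_iff) auto
        hence "norm (G (s *\<^sub>R z)) powr p \<le> C1 * q / (d / 2) ^ ?N"
          using d by (simp add: field_simps)
        hence "(norm (G (s *\<^sub>R z)) powr p) powr (1 / p) \<le> B"
          unfolding B_def using p by (intro powr_mono2) auto
        thus ?thesis using p by (simp add: powr_powr)
      qed
      have B0: "B \<ge> 0" by (simp add: B_def)
      define \<phi> where "\<phi> = (\<lambda>s. of_real s ^ c * F (s *\<^sub>R z))"
      have "norm (\<phi> 1 - \<phi> t) \<le> (2 * B) * norm (1 - t)"
      proof (rule differentiable_bound[where S = "{t..1}"])
        fix s assume s: "s \<in> {t..1}"
        hence s0: "s \<ge> 1/2" "s \<le> 1" using t' by auto
        have "norm (s *\<^sub>R z) \<le> norm z"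
          using s0 by (simp add: mult_left_le_one_le)
        hence sz: "s *\<^sub>R z \<in> ball 0 1" using z by simp
        have "(\<phi> has_vector_derivative of_real (s ^ c / s) * G (s *\<^sub>R z)) (at s)"
          unfolding \<phi>_def G_def using s0 by (intro radial_power_has_vector_derivative[OF F _ _ sz]) auto
        thus "(\<phi> has_derivative (\<lambda>h. h *\<^sub>R (of_real (s ^ c / s) * G (s *\<^sub>R z)))) (at s within {t..1})"
          by (simp add: has_vector_derivative_def has_derivative_at_withinI)
        have "s ^ c / s \<le> 1 / (1/2)"
          using s0 by (intro frac_le power_le_one) auto
        hence "s ^ c / s * norm (G (s *\<^sub>R z)) \<le> 2 * B"
          using GB[OF s] s0 B0 by (intro mult_mono) auto
        hence "norm (of_real (s ^ c / s) * G (s *\<^sub>R z)) \<le> 2 * B"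
          using s0 by (simp add: norm_mult norm_divide norm_power)
        thus "onorm (\<lambda>h. h *\<^sub>R (of_real (s ^ c / s) * G (s *\<^sub>R z))) \<le> 2 * B"
          using B0 by (intro onorm_bound) (auto simp: mult.commute[of "2 * B"] intro!: mult_left_mono)
      qed (use t' in auto)
      also have "\<dots> \<le> (2 * B) * (2 * L * d)"
        using B0 t' by (intro mult_left_mono) auto
      also have "\<phi> 1 - \<phi> t = F z - of_real t ^ c * F (t *\<^sub>R z)"
        by (simp add: \<phi>_def)
      finally have "norm (F z - of_real t ^ c * F (t *\<^sub>R z)) powr p \<le> (2 * B * (2 * L * d)) powr p"
        using p by (intro powr_mono2) auto
      also have "\<dots> = 4 powr p * L powr p * d powr p * B powr p"
        using L d B0 by (simp add: powr_mult flip: powr_mult)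
           (simp add: powr_mult mult_ac)
      also have "B powr p = C1 * q / (d / 2) ^ ?N"
        using p C1 real d by (simp add: B_def powr_powr)
      also have "4 powr p * L powr p * d powr p * (C1 * q / (d / 2) ^ ?N) = C * L powr p * d powr (p - ?N) * q"
      proof -
        have "d powr (p - ?N) = d powr p / d ^ ?N"
          using powr_realpow[OF d(1), of ?N] by (simp add: powr_diff)
        thus ?thesis using d by (simp add: C_def power_divide)
      qed
      finally show ?thesis
        using C L real by (simp add: ennreal_leI flip: ennreal_mult)
    qed (use C L d in \<open>simp add: ennreal_mult_top\<close>)
    thus ?thesis by (simp add: Q_def G_def d_def)
  qed
  thus ?thesis using C by blast
qed

section \<open>A Hardy inequality for the radial derivative\<close>

text \<open>A priori finiteness away from the sphere.  It starts the absorption argument below and also disposes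
of the points at which the dilations would reach too far.\<close>

lemma weighted_integral_cball_finite:
  fixes F :: "complex ^ 'n \<Rightarrow> complex"
  assumes p: "p > 0" and F: "continuous_on (ball 0 1) F" and r: "r < 1"
  shows "(\<integral>\<^sup>+w. indicator (cball 0 r) w * ennreal ((1 - norm w) powr \<beta> * norm (F w) powr p) \<partial>lborel) < \<infinity>"
proof -
  have sub: "cball (0::complex ^ 'n) r \<subseteq> ball 0 1" using r by auto
  have "continuous_on (cball 0 r) (\<lambda>w. (1 - norm w) powr \<beta> * norm (F w) powr p)"
    using r by (intro continuous_intros continuous_on_norm_powr[OF continuous_on_subset[OF F sub] p]) auto
  hence "bounded ((\<lambda>w. (1 - norm w) powr \<beta> * norm (F w) powr p) ` cball 0 r)"
    by (intro compact_imp_bounded compact_continuous_image) auto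
  then obtain B where "\<forall>x\<in>(\<lambda>w. (1 - norm w) powr \<beta> * norm (F w) powr p) ` cball 0 r. norm x \<le> B"
    unfolding bounded_iff by blast
  hence B: "norm ((1 - norm w) powr \<beta> * norm (F w) powr p) \<le> B" if "w \<in> cball 0 r" for w
    using that by blast
  have "(\<integral>\<^sup>+w. indicator (cball 0 r) w * ennreal ((1 - norm w) powr \<beta> * norm (F w) powr p) \<partial>lborel)
     \<le> (\<integral>\<^sup>+w. ennreal B * indicator (cball (0::complex ^ 'n) r) w \<partial>lborel)"
  proof (rule nn_integral_mono)
    fix w :: "complex ^ 'n"
    show "indicator (cball 0 r) w * ennreal ((1 - norm w) powr \<beta> * norm (F w) powr p)
        \<le> ennreal B * indicator (cball 0 r) w"
      using B[of w] by (cases "w \<in> cball 0 r") (auto intro!: ennreal_leI)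
  qed
  also have "\<dots> = ennreal B * emeasure lborel (cball (0::complex ^ 'n) r)"
    by (rule nn_integral_cmult_indicator) simp
  also have "\<dots> < \<infinity>"
    using emeasure_lborel_cball_finite[of "0::complex ^ 'n" r] by (simp add: ennreal_mult_less_top)
  finally show ?thesis .
qed

lemma powr_add_le:
  fixes a b p :: real
  assumes "a \<ge> 0" "b \<ge> 0" "p > 0"
  shows "(a + b) powr p \<le> 2 powr p * (a powr p + b powr p)"
proof -
  have "(a + b) powr p \<le> (2 * max a b) powr p"
    using assms by (intro powr_mono2) auto
  also have "\<dots> = 2 powr p * max a b powr p"
    using assms by (simp add: powr_mult)
  also have "max a b powr p \<le> a powr p + b powr p"
    by (simp add: max_def)
  finally show ?thesis by simp
qed

lemma ennreal_absorb_half: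
  fixes J X :: ennreal
  assumes "J < \<infinity>" "J \<le> X + ennreal (1/2) * J"
  shows "J \<le> 2 * X"
proof (cases X)
  case (real x)
  obtain j where j: "J = ennreal j" "j \<ge> 0" using assms(1) by (cases J) auto
  have "ennreal (1/2) * ennreal j = ennreal (1/2 * j)"
    using j by (intro ennreal_mult[symmetric]) auto
  moreover have "ennreal x + ennreal (1/2 * j) = ennreal (x + 1/2 * j)"
    using real j by (intro ennreal_plus[symmetric]) auto
  ultimately have "ennreal j \<le> ennreal (x + 1/2 * j)"
    using assms(2) real j by metis
  hence "j \<le> x + 1/2 * j" using real j by (subst (asm) ennreal_le_iff) auto
  hence "ennreal j \<le> ennreal (2 * x)" by (intro ennreal_leI) auto
  thus ?thesis using real j by (simp add: ennreal_mult)
qed (simp add: ennreal_mult_top)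

text \<open>Absorption needs a finite integral on the left, so the estimate is first proved for $F$ cut off to a
ball of radius $\rho < 1$, with a bound independent of $\rho$.  The cut-off is harmless since the
dilated point $tz$ lies in any ball around the origin that contains $z$.  The choice of \<open>L\<close> makes
the factor $2^p C_1 L^{-\beta-1}$ in front of the absorbed term at most $1/2$; \<open>E\<close> collects the
contribution of $RF + cF$, and \<open>K\<close> that of the points with $L\delta(z) > 1/4$.\<close>

theorem weighted_integral_radial_finite:
  fixes p \<beta> :: real and F :: "complex ^ 'n \<Rightarrow> complex" and c :: nat
  assumes p: "p > 0" and \<beta>: "\<beta> > -1" and F: "holomorphic_vec_on F (ball 0 1)"
  assumes fin: "weighted_integral p (\<beta> + p) (\<lambda>z. radial_deriv F z + of_nat c * F z) < \<infinity>"
  shows "weighted_integral p \<beta> F < \<infinity>"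
proof -
  let ?N = "DIM(complex ^ 'n)"
  define G where "G = (\<lambda>z. radial_deriv F z + of_nat c * F z)"
  have G: "holomorphic_vec_on G (ball 0 1)"
    unfolding G_def using F by (intro holomorphic_vec_on_radial) auto
  note contF = holomorphic_vec_on_continuous[OF F]
  define gG where "gG = (\<lambda>w. indicator (ball 0 1) w * ennreal (norm (G w) powr p))"
  have gG [measurable]: "gG \<in> borel_measurable borel"
    unfolding gG_def using p
    by (intro borel_measurable_indicator_times_continuous continuous_on_norm_powr holomorphic_vec_on_continuous[OF G]) auto

  obtain C1 where C1: "C1 \<ge> 0" and dil: "\<And>L g. L \<ge> 1 \<Longrightarrow> g \<in> borel_measurable borel \<Longrightarrow>
     (\<integral>\<^sup>+z. (\<integral>\<^sup>+t. ennreal ((1 - norm z) powr (\<beta> - 1) / L) * g (t *\<^sub>R z)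
         * indicator {t. norm z < 1 \<and> L * (1 - norm z) \<le> 1/4 \<and>
              L * (1 - norm z) \<le> 1 - t \<and> 1 - t \<le> 2 * L * (1 - norm z)} t \<partial>lborel) \<partial>lborel)
     \<le> ennreal (C1 * L powr (- \<beta> - 1)) * (\<integral>\<^sup>+w. indicator (ball 0 1) w * ennreal ((1 - norm w) powr \<beta>) * g (w::complex ^ 'n) \<partial>lborel)"
    using nn_integral_dilation_average_le[of \<beta>, where 'a = "complex ^ 'n"] by blast
  define L where "L = max 1 ((2 * 2 powr p * C1) powr (1 / (\<beta> + 1)))"
  \<comment> \<open>The second entry of the maximum ensures $L^{\beta + 1} \ge 2 \cdot 2^p C_1$.\<close>
  have L: "L \<ge> 1" by (simp add: L_def)
  have half: "2 powr p * (C1 * L powr (- \<beta> - 1)) \<le> 1/2"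
  proof -
    have "2 * 2 powr p * C1 = ((2 * 2 powr p * C1) powr (1 / (\<beta> + 1))) powr (\<beta> + 1)"
      using \<beta> C1 by (simp add: powr_powr)
    also have "\<dots> \<le> L powr (\<beta> + 1)"
      using \<beta> by (intro powr_mono2) (auto simp: L_def)
    finally have "2 * 2 powr p * C1 * L powr (- \<beta> - 1) \<le> L powr (\<beta> + 1) * L powr (- \<beta> - 1)"
      by (intro mult_right_mono) auto
    also have "\<dots> = 1" using L by (simp flip: powr_add)
    finally show ?thesis by simp
  qed
  obtain C2 where C2: "C2 > 0" and incr: "\<And>(z :: complex ^ 'n) t. norm z < 1 \<Longrightarrow>
      L * (1 - norm z) \<le> 1/4 \<Longrightarrow> L * (1 - norm z) \<le> 1 - t \<Longrightarrow> 1 - t \<le> 2 * L * (1 - norm z) \<Longrightarrow>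
      ennreal (norm (F z - of_real t ^ c * F (t *\<^sub>R z)) powr p)
        \<le> ennreal (C2 * L powr p * (1 - norm z) powr (p - ?N)) *
           (\<integral>\<^sup>+w. gG w * indicator {w. within_reach (2 * L + 1) z w} w \<partial>lborel)"
    using radial_increment_le[OF p, where 'n = 'n] F L unfolding gG_def G_def by meson
  obtain C3 where C3: "C3 \<ge> 0" and loc: "\<And>g. g \<in> borel_measurable borel \<Longrightarrow>
     (\<integral>\<^sup>+z. (\<integral>\<^sup>+w. ennreal ((1 - norm z) powr (\<beta> + p - ?N)) * g w
          * indicator {w. within_reach (2 * L + 1) z w} w \<partial>lborel) \<partial>lborel)
     \<le> ennreal C3 * (\<integral>\<^sup>+w. indicator (ball 0 1) w * ennreal ((1 - norm w) powr (\<beta> + p)) * g (w::complex ^ 'n) \<partial>lborel)"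
    using nn_integral_local_average_le[of "2 * L + 1" "\<beta> + p", where 'a = "complex ^ 'n"] L by auto

  define P where "P = (\<lambda>(z::complex ^ 'n) t. norm z < 1 \<and> L * (1 - norm z) \<le> 1/4 \<and>
              L * (1 - norm z) \<le> 1 - t \<and> 1 - t \<le> 2 * L * (1 - norm z))"
  define K where "K = (\<integral>\<^sup>+w. indicator (cball 0 (1 - 1 / (4 * L))) w * ennreal ((1 - norm w) powr \<beta> * norm (F w) powr p) \<partial>lborel)"
  define E where "E = ennreal (2 powr p * (C2 * L powr p)) * (ennreal C3 * weighted_integral p (\<beta> + p) G)"
  have K: "K < \<infinity>"
    unfolding K_def using L by (intro weighted_integral_cball_finite[OF p contF]) auto
  have E: "E < \<infinity>"
    using fin by (simp add: E_def G_def ennreal_mult_less_top)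

  have J_le: "(\<integral>\<^sup>+w. indicator (ball 0 \<rho>) w * ennreal ((1 - norm w) powr \<beta> * norm (F w) powr p) \<partial>lborel) \<le> 2 * (K + E)"
    if \<rho>: "\<rho> < 1" for \<rho>
  proof -
    define g where "g = (\<lambda>w. indicator (ball 0 \<rho>) w * ennreal (norm (F w) powr p))"
    have g [measurable]: "g \<in> borel_measurable borel"
      unfolding g_def using p \<rho>
      by (intro borel_measurable_indicator_times_continuous continuous_on_norm_powr continuous_on_subset[OF contF]) auto
    define J where "J = (\<integral>\<^sup>+w. indicator (ball 0 \<rho>) w * ennreal ((1 - norm w) powr \<beta> * norm (F w) powr p) \<partial>lborel)"
    have J_eq: "J = (\<integral>\<^sup>+w. indicator (ball 0 1) w * ennreal ((1 - norm w) powr \<beta>) * g w \<partial>lborel)"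
      unfolding J_def g_def using \<rho> by (intro nn_integral_cong) (auto simp: indicator_def ennreal_mult)
    have "J \<le> (\<integral>\<^sup>+w. indicator (cball 0 \<rho>) w * ennreal ((1 - norm w) powr \<beta> * norm (F w) powr p) \<partial>lborel)"
      unfolding J_def by (intro nn_integral_mono mult_right_mono) (auto simp: indicator_def)
    also have "\<dots> < \<infinity>" by (rule weighted_integral_cball_finite[OF p contF \<rho>])
    finally have J_fin: "J < \<infinity>" .

    define I1 where "I1 = (\<lambda>z. \<integral>\<^sup>+t. ennreal ((1 - norm z) powr (\<beta> - 1) / L) * g (t *\<^sub>R z) * indicator {t. P z t} t \<partial>lborel)"
    define I2 where "I2 = (\<lambda>z::complex ^ 'n. \<integral>\<^sup>+w. ennreal ((1 - norm z) powr (\<beta> + p - ?N)) * gG w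
          * indicator {w. within_reach (2 * L + 1) z w} w \<partial>lborel)"
    define k0 where "k0 = (\<lambda>w. indicator (cball 0 (1 - 1 / (4 * L))) w * ennreal ((1 - norm w) powr \<beta> * norm (F w) powr p))"
    have I1_meas [measurable]: "I1 \<in> borel_measurable borel"
      unfolding I1_def P_def by measurable
    have I2_meas [measurable]: "I2 \<in> borel_measurable borel"
      unfolding I2_def by measurable
    have k0_meas [measurable]: "k0 \<in> borel_measurable borel"
    proof -
      have "cball 0 (1 - 1 / (4 * L)) \<subseteq> ball (0 :: complex ^ 'n) 1"
        using L by (subst cball_subset_ball_iff) simp
      hence "(\<lambda>w. indicator (cball 0 (1 - 1 / (4 * L))) w *\<^sub>R ((1 - norm w) powr \<beta> * norm (F w) powr p)) \<in> borel_measurable borel"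
        by (intro borel_measurable_continuous_on_indicator continuous_intros continuous_on_norm_powr[OF _ p] continuous_on_subset[OF contF]) auto
      hence "(\<lambda>w. ennreal (indicator (cball 0 (1 - 1 / (4 * L))) w *\<^sub>R ((1 - norm w) powr \<beta> * norm (F w) powr p))) \<in> borel_measurable borel"
        by measurable
      also have "(\<lambda>w. ennreal (indicator (cball 0 (1 - 1 / (4 * L))) w *\<^sub>R ((1 - norm w) powr \<beta> * norm (F w) powr p))) = k0"
        by (auto simp: k0_def indicator_def)
      finally show ?thesis .
    qed

    have pw: "indicator (ball 0 \<rho>) z * ennreal ((1 - norm z) powr \<beta> * norm (F z) powr p)
        \<le> k0 z + (ennreal (2 powr p) * I1 z + ennreal (2 powr p * (C2 * L powr p)) * I2 z)" for z
    proof (cases "z \<in> ball 0 \<rho>")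
      case z\<rho>: True
      define d where "d = 1 - norm z"
      have d: "d > 0" "norm z < 1" using z\<rho> \<rho> by (auto simp: d_def)
      show ?thesis
      proof (cases "L * d \<le> 1/4")
        case False
        hence "z \<in> cball 0 (1 - 1 / (4 * L))"
          using L by (simp add: d_def field_simps)
        thus ?thesis using z\<rho> by (simp add: k0_def add_increasing2)
      next
        case True
        have Ld: "L * d > 0" using L d by simp
        have T: "{t. P z t} = {1 - 2 * L * d..1 - L * d}"
          using True d by (auto simp: P_def d_def)
        define Q where "Q = (\<integral>\<^sup>+w. gG w * indicator {w. within_reach (2 * L + 1) z w} w \<partial>lborel)"
        define e where "e = ennreal (C2 * L powr p * d powr (p - ?N)) * Q"
        have step: "ennreal (norm (F z) powr p) \<le> ennreal (2 powr p) * g (t *\<^sub>R z) + ennreal (2 powr p) * e" if t: "P z t" for t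
        proof -
          have t01: "0 \<le> t" "t \<le> 1"
            using t True Ld unfolding P_def d_def[symmetric] by linarith+
          have tz: "t *\<^sub>R z \<in> ball 0 \<rho>"
            using z\<rho> t01 mult_left_le_one_le[of "norm z" t] by simp
          have "norm (F z) \<le> norm (of_real t ^ c * F (t *\<^sub>R z)) + norm (F z - of_real t ^ c * F (t *\<^sub>R z))"
            using norm_triangle_ineq[of "of_real t ^ c * F (t *\<^sub>R z)" "F z - of_real t ^ c * F (t *\<^sub>R z)"] by simp
          moreover have "norm (of_real t ^ c * F (t *\<^sub>R z)) \<le> norm (F (t *\<^sub>R z))"
            using t01 by (simp add: norm_mult norm_power mult_left_le_one_le power_le_one)
          ultimately have "norm (F z) powr p \<le> (norm (F (t *\<^sub>R z)) + norm (F z - of_real t ^ c * F (t *\<^sub>R z))) powr p"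
            using p by (intro powr_mono2) auto
          also have "\<dots> \<le> 2 powr p * (norm (F (t *\<^sub>R z)) powr p + norm (F z - of_real t ^ c * F (t *\<^sub>R z)) powr p)"
            using p by (intro powr_add_le) auto
          finally have "ennreal (norm (F z) powr p) \<le> ennreal (2 powr p) * ennreal (norm (F (t *\<^sub>R z)) powr p)
              + ennreal (2 powr p) * ennreal (norm (F z - of_real t ^ c * F (t *\<^sub>R z)) powr p)"
            by (simp add: ennreal_leI distrib_left flip: ennreal_mult ennreal_plus)
          also have "ennreal (norm (F z - of_real t ^ c * F (t *\<^sub>R z)) powr p) \<le> e"
            unfolding e_def Q_def d_def using t by (intro incr) (auto simp: P_def)
          finally show ?thesis using tz by (simp add: g_def mult_left_mono)
        qed
        \<comment> \<open>The admissible $t$ form an interval of length $L\delta(z)$, so the kernel $\delta^{\beta-1}/L$ integrates to $\delta^\beta$ and the left hand side is its own average over $t$.\<close>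
        have "ennreal (d powr \<beta>) * ennreal (norm (F z) powr p)
            = (\<integral>\<^sup>+t. (ennreal (d powr (\<beta> - 1) / L) * ennreal (norm (F z) powr p)) * indicator {t. P z t} t \<partial>lborel)"
        proof -
          have "d powr (\<beta> - 1) / L * (L * d) = d powr \<beta>"
            using L d by (simp add: powr_diff)
          hence "ennreal (d powr \<beta>) = ennreal (d powr (\<beta> - 1) / L) * ennreal (L * d)"
            using L d by (simp flip: ennreal_mult)
          moreover have "emeasure lborel {t. P z t} = ennreal (L * d)"
            unfolding T using Ld by simp
          ultimately show ?thesis
            by (subst nn_integral_cmult_indicator) (auto simp: T mult_ac)
        qed
        also have "\<dots> \<le> (\<integral>\<^sup>+t. ennreal (2 powr p) * (ennreal (d powr (\<beta> - 1) / L) * g (t *\<^sub>R z) * indicator {t. P z t} t)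
            + (ennreal (d powr (\<beta> - 1) / L) * (ennreal (2 powr p) * e)) * indicator {t. P z t} t \<partial>lborel)"
        proof (rule nn_integral_mono)
          fix t
          show "(ennreal (d powr (\<beta> - 1) / L) * ennreal (norm (F z) powr p)) * indicator {t. P z t} t \<le>
            ennreal (2 powr p) * (ennreal (d powr (\<beta> - 1) / L) * g (t *\<^sub>R z) * indicator {t. P z t} t)
            + (ennreal (d powr (\<beta> - 1) / L) * (ennreal (2 powr p) * e)) * indicator {t. P z t} t"
          proof (cases "P z t")
            case P: True
            have "ennreal (d powr (\<beta> - 1) / L) * ennreal (norm (F z) powr p) \<le>
              ennreal (d powr (\<beta> - 1) / L) * (ennreal (2 powr p) * g (t *\<^sub>R z) + ennreal (2 powr p) * e)"
              by (intro mult_left_mono step P) auto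
            thus ?thesis using P by (simp add: distrib_left mult_ac)
          qed auto
        qed
        also have "\<dots> = ennreal (2 powr p) * I1 z + (\<integral>\<^sup>+t. (ennreal (d powr (\<beta> - 1) / L) * (ennreal (2 powr p) * e)) * indicator {t. P z t} t \<partial>lborel)"
        proof -
          have [measurable]: "{t. P z t} \<in> sets borel" by (simp add: T)
          show ?thesis
            unfolding I1_def d_def[symmetric]
            by (subst nn_integral_add) (simp_all add: nn_integral_cmult)
        qed
        also have "(\<integral>\<^sup>+t. (ennreal (d powr (\<beta> - 1) / L) * (ennreal (2 powr p) * e)) * indicator {t. P z t} t \<partial>lborel)
            = ennreal (2 powr p * (C2 * L powr p)) * I2 z"
        proof -
          have I2z: "I2 z = ennreal (d powr (\<beta> + p - ?N)) * Q"
            unfolding I2_def Q_def d_def by (simp add: nn_integral_cmult mult.assoc)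
          have eq: "d powr (\<beta> - 1) / L * 2 powr p * (C2 * L powr p * d powr (p - ?N)) * (L * d) = 2 powr p * (C2 * L powr p) * d powr (\<beta> + p - ?N)"
          proof -
            have "d powr (\<beta> + p - ?N) = d powr (\<beta> - 1) * d powr 1 * d powr (p - ?N)"
              by (simp only: powr_add[symmetric]) (simp add: algebra_simps)
            thus ?thesis using d L by simp
          qed
          have "(\<integral>\<^sup>+t. (ennreal (d powr (\<beta> - 1) / L) * (ennreal (2 powr p) * e)) * indicator {t. P z t} t \<partial>lborel)
            = ennreal (d powr (\<beta> - 1) / L) * (ennreal (2 powr p) * e) * ennreal (L * d)"
            using Ld by (subst nn_integral_cmult_indicator) (auto simp: T)
          also have "\<dots> = ennreal (d powr (\<beta> - 1) / L * 2 powr p * (C2 * L powr p * d powr (p - ?N)) * (L * d)) * Q"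
            using C2 L d by (simp only: e_def ennreal_mult mult_nonneg_nonneg divide_nonneg_nonneg powr_ge_zero less_imp_le mult_ac
               order.trans[OF zero_le_one L])
          also have "\<dots> = ennreal (2 powr p * (C2 * L powr p)) * I2 z"
            unfolding eq I2z using C2 by (simp add: ennreal_mult mult.assoc)
          finally show ?thesis .
        qed
        finally show ?thesis using z\<rho> by (simp add: d_def ennreal_mult add_increasing)
      qed
    qed auto
    have "J \<le> (\<integral>\<^sup>+z. k0 z + (ennreal (2 powr p) * I1 z + ennreal (2 powr p * (C2 * L powr p)) * I2 z) \<partial>lborel)"
      unfolding J_def by (rule nn_integral_mono) (rule pw)
    also have "\<dots> = K + (ennreal (2 powr p) * (\<integral>\<^sup>+z. I1 z \<partial>lborel) + ennreal (2 powr p * (C2 * L powr p)) * (\<integral>\<^sup>+z. I2 z \<partial>lborel))"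
      unfolding K_def k0_def[symmetric] by (simp add: nn_integral_add nn_integral_cmult)
    also have "\<dots> \<le> K + (ennreal (2 powr p) * (ennreal (C1 * L powr (- \<beta> - 1)) * J) + E)"
    proof -
      have "(\<integral>\<^sup>+z. I1 z \<partial>lborel) \<le> ennreal (C1 * L powr (- \<beta> - 1)) * J"
        unfolding I1_def P_def J_eq by (rule dil[OF L g])
      moreover have "(\<integral>\<^sup>+z. I2 z \<partial>lborel) \<le> ennreal C3 * weighted_integral p (\<beta> + p) G"
      proof -
        have "(\<integral>\<^sup>+w. indicator (ball 0 1) w * ennreal ((1 - norm w) powr (\<beta> + p)) * gG w \<partial>lborel) = weighted_integral p (\<beta> + p) G"
          unfolding weighted_integral_def gG_def by (intro nn_integral_cong) (simp add: indicator_def)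
        thus ?thesis using loc[OF gG] by (simp add: I2_def)
      qed
      ultimately show ?thesis
        unfolding E_def by (intro add_mono mult_left_mono) auto
    qed
    also have "ennreal (2 powr p) * (ennreal (C1 * L powr (- \<beta> - 1)) * J) = ennreal (2 powr p * (C1 * L powr (- \<beta> - 1))) * J"
      using C1 by (simp add: ennreal_mult mult.assoc)
    also have "\<dots> \<le> ennreal (1/2) * J"
      using half by (intro mult_right_mono ennreal_leI) auto
    finally have "J \<le> K + E + ennreal (1/2) * J"
      by (simp add: add_ac)
    from ennreal_absorb_half[OF J_fin this] show ?thesis by (simp add: J_def)
  qed

  \<comment> \<open>Let the cut-off radius tend to one.\<close>
  define f where "f = (\<lambda>m w. indicator (ball (0::complex ^ 'n) (1 - 1 / real (m + 1))) w * ennreal ((1 - norm w) powr \<beta> * norm (F w) powr p))"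
  have f_meas: "f m \<in> borel_measurable lborel" for m
  proof -
    have "ball 0 (1 - 1 / real (m + 1)) \<subseteq> ball (0::complex ^ 'n) 1" by (intro subset_ball) auto
    thus ?thesis
      unfolding f_def measurable_lborel2
      by (intro borel_measurable_indicator_times_continuous continuous_intros continuous_on_norm_powr[OF _ p] continuous_on_subset[OF contF]) auto
  qed
  have "incseq f"
  proof (rule incseq_SucI, rule le_funI)
    fix m and w :: "complex ^ 'n"
    have "ball (0::complex ^ 'n) (1 - 1 / real (m + 1)) \<subseteq> ball 0 (1 - 1 / real (Suc m + 1))"
      by (intro subset_ball diff_left_mono frac_le) auto
    hence "indicator (ball 0 (1 - 1 / real (m + 1))) w \<le> (indicator (ball 0 (1 - 1 / real (Suc m + 1))) w :: ennreal)"
      by (auto simp: indicator_def)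
    thus "f m w \<le> f (Suc m) w" unfolding f_def by (rule mult_right_mono) simp
  qed
  have "weighted_integral p \<beta> F \<le> (\<integral>\<^sup>+w. (SUP m. f m w) \<partial>lborel)"
    unfolding weighted_integral_def
  proof (rule nn_integral_mono)
    fix w :: "complex ^ 'n"
    show "indicator (ball 0 1) w * ennreal ((1 - norm w) powr \<beta>) * ennreal (norm (F w) powr p) \<le> (SUP m. f m w)"
    proof (cases "norm w < 1")
      case True
      then obtain m where m: "inverse (real (Suc m)) < 1 - norm w"
        using reals_Archimedean[of "1 - norm w"] by auto
      hence "norm w < 1 - 1 / real (m + 1)"
        by (simp add: inverse_eq_divide)
      hence "f m w = indicator (ball 0 1) w * ennreal ((1 - norm w) powr \<beta>) * ennreal (norm (F w) powr p)"
        using True by (simp add: f_def ennreal_mult)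
      thus ?thesis by (metis SUP_upper UNIV_I)
    qed auto
  qed
  also have "\<dots> = (SUP m. \<integral>\<^sup>+w. f m w \<partial>lborel)"
    by (rule nn_integral_monotone_convergence_SUP[OF \<open>incseq f\<close> f_meas])
  also have "\<dots> \<le> 2 * (K + E)"
    unfolding f_def by (intro SUP_least J_le) auto
  also have "\<dots> < \<infinity>"
    using K E by (simp add: ennreal_mult_less_top)
  finally show ?thesis .
qed

section \<open>Classes of holomorphic functions and the order of derivatives\<close>

definition weighted_class :: "real \<Rightarrow> real \<Rightarrow> (complex ^ 'n \<Rightarrow> complex) \<Rightarrow> bool" where
  "weighted_class p \<beta> F \<longleftrightarrow> holomorphic_vec_on F (ball 0 1) \<and> weighted_integral p \<beta> F < \<infinity>"

lemma weighted_class_cong: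
  assumes "weighted_class p \<beta> F" "\<And>z. norm z < 1 \<Longrightarrow> F z = G z"
  shows "weighted_class p \<beta> G"
proof -
  have "weighted_integral p \<beta> F = weighted_integral p \<beta> G"
    unfolding weighted_integral_def using assms(2)
    by (intro nn_integral_cong) (auto simp: indicator_def)
  thus ?thesis
    using assms holomorphic_vec_on_cong[of "ball 0 1" F G] by (simp add: weighted_class_def)
qed

lemma weighted_class_mono_exponent:
  assumes "weighted_class p \<beta> F" "\<beta> \<le> \<gamma>"
  shows "weighted_class p \<gamma> F"
proof -
  have "weighted_integral p \<gamma> F \<le> weighted_integral p \<beta> F"
    unfolding weighted_integral_def using assms(2)
    by (intro nn_integral_mono) (auto simp: indicator_def intro!: mult_right_mono ennreal_leI powr_mono')
  thus ?thesis using assms(1) by (auto simp: weighted_class_def)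
qed

lemma weighted_class_zero: "p > 0 \<Longrightarrow> weighted_class p \<beta> (\<lambda>_. 0)"
  unfolding weighted_class_def weighted_integral_def
  by (auto intro!: holomorphic_vec_onI derivative_eq_intros)

lemma weighted_class_add:
  assumes F: "weighted_class p \<beta> F" and G: "weighted_class p \<beta> G" and p: "p > 0"
  shows "weighted_class p \<beta> (\<lambda>z. F z + G (z :: complex ^ 'n))"
proof -
  have hF: "holomorphic_vec_on F (ball 0 1)" and hG: "holomorphic_vec_on G (ball 0 1)"
    using F G by (auto simp: weighted_class_def)
  have "holomorphic_vec_on (\<lambda>z. F z + G z) (ball 0 1)"
  proof (rule holomorphic_vec_onI)
    fix z :: "complex ^ 'n" assume z: "z \<in> ball 0 1"
    obtain D where D: "(F has_derivative D) (at z)" "\<And>c v. D (c *s v) = c * D v"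
      using holomorphic_vec_onE[OF hF open_ball z] by blast
    obtain E where E: "(G has_derivative E) (at z)" "\<And>c v. E (c *s v) = c * E v"
      using holomorphic_vec_onE[OF hG open_ball z] by blast
    show "\<exists>D. ((\<lambda>z. F z + G z) has_derivative D) (at z) \<and> (\<forall>c v. D (c *s v) = c * D v)"
      by (intro exI[of _ "\<lambda>v. D v + E v"] conjI has_derivative_add D(1) E(1))
         (simp add: D(2) E(2) algebra_simps)
  qed
  moreover have "weighted_integral p \<beta> (\<lambda>z. F z + G z) < \<infinity>"
  proof -
    let ?w = "\<lambda>w::complex ^ 'n. indicator (ball 0 1) w * ennreal ((1 - norm w) powr \<beta>)"
    have meas: "(\<lambda>w. ?w w * ennreal (norm (H w) powr p)) \<in> borel_measurable borel"
      if "holomorphic_vec_on H (ball 0 1)" for H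
    proof -
      have "(\<lambda>w. indicator (ball 0 1) w * ennreal ((1 - norm w) powr \<beta> * norm (H w) powr p)) \<in> borel_measurable borel"
        by (intro borel_measurable_indicator_times_continuous continuous_intros
            continuous_on_norm_powr[OF holomorphic_vec_on_continuous[OF that] p]) auto
      thus ?thesis by (simp add: ennreal_mult mult.assoc)
    qed
    have "weighted_integral p \<beta> (\<lambda>z. F z + G z)
        \<le> (\<integral>\<^sup>+w. ennreal (2 powr p) * (?w w * ennreal (norm (F w) powr p) + ?w w * ennreal (norm (G w) powr p)) \<partial>lborel)"
      unfolding weighted_integral_def
    proof (rule nn_integral_mono)
      fix w :: "complex ^ 'n"
      have "norm (F w + G w) powr p \<le> (norm (F w) + norm (G w)) powr p"
        using p by (intro powr_mono2 norm_triangle_ineq) auto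
      also have "\<dots> \<le> 2 powr p * (norm (F w) powr p + norm (G w) powr p)"
        using p by (intro powr_add_le) auto
      finally have "ennreal (norm (F w + G w) powr p) \<le> ennreal (2 powr p) * (ennreal (norm (F w) powr p) + ennreal (norm (G w) powr p))"
        by (simp add: ennreal_leI flip: ennreal_mult ennreal_plus)
      hence "?w w * ennreal (norm (F w + G w) powr p) \<le> ?w w * (ennreal (2 powr p) * (ennreal (norm (F w) powr p) + ennreal (norm (G w) powr p)))"
        by (rule mult_left_mono) simp
      thus "?w w * ennreal (norm (F w + G w) powr p)
        \<le> ennreal (2 powr p) * (?w w * ennreal (norm (F w) powr p) + ?w w * ennreal (norm (G w) powr p))"
        by (simp add: distrib_left mult_ac)
    qed
    also have "\<dots> = ennreal (2 powr p) * (weighted_integral p \<beta> F + weighted_integral p \<beta> G)"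
      unfolding weighted_integral_def using meas[OF hF] meas[OF hG]
      by (subst nn_integral_cmult) (auto simp: nn_integral_add)
    also have "\<dots> < \<infinity>"
      using F G by (simp add: weighted_class_def ennreal_mult_less_top)
    finally show ?thesis .
  qed
  ultimately show ?thesis by (simp add: weighted_class_def)
qed

lemma weighted_class_mult_bounded:
  assumes F: "weighted_class p \<beta> F" and H: "holomorphic_vec_on H (ball (0 :: complex ^ 'n) 1)" and p: "p > 0"
    and B: "\<And>z. norm z < 1 \<Longrightarrow> norm (H z) \<le> B"
  shows "weighted_class p \<beta> (\<lambda>z. H z * F z)"
proof -
  have hF: "holomorphic_vec_on F (ball 0 1)" using F by (auto simp: weighted_class_def)
  have "holomorphic_vec_on (\<lambda>z. H z * F z) (ball 0 1)"
  proof (rule holomorphic_vec_onI)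
    fix z :: "complex ^ 'n" assume z: "z \<in> ball 0 1"
    obtain D where D: "(H has_derivative D) (at z)" "\<And>c v. D (c *s v) = c * D v"
      using holomorphic_vec_onE[OF H open_ball z] by blast
    obtain E where E: "(F has_derivative E) (at z)" "\<And>c v. E (c *s v) = c * E v"
      using holomorphic_vec_onE[OF hF open_ball z] by blast
    show "\<exists>D. ((\<lambda>z. H z * F z) has_derivative D) (at z) \<and> (\<forall>c v. D (c *s v) = c * D v)"
      by (intro exI[of _ "\<lambda>v. H z * E v + D v * F z"] conjI has_derivative_mult D(1) E(1))
         (simp add: D(2) E(2) algebra_simps)
  qed
  moreover have "weighted_integral p \<beta> (\<lambda>z. H z * F z) < \<infinity>"
  proof -
    have B0: "B \<ge> 0" using B[of 0] by (smt (verit) norm_ge_zero norm_zero)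
    have "weighted_integral p \<beta> (\<lambda>z. H z * F z) \<le> (\<integral>\<^sup>+w. ennreal (B powr p) * (indicator (ball 0 1) w * ennreal ((1 - norm w) powr \<beta>) * ennreal (norm (F w) powr p)) \<partial>lborel)"
      unfolding weighted_integral_def
    proof (rule nn_integral_mono)
      fix w :: "complex ^ 'n"
      show "indicator (ball 0 1) w * ennreal ((1 - norm w) powr \<beta>) * ennreal (norm (H w * F w) powr p)
        \<le> ennreal (B powr p) * (indicator (ball 0 1) w * ennreal ((1 - norm w) powr \<beta>) * ennreal (norm (F w) powr p))"
      proof (cases "norm w < 1")
        case True
        have "norm (H w * F w) powr p \<le> B powr p * norm (F w) powr p"
          using B[OF True] p B0 by (auto simp: norm_mult powr_mult intro!: mult_right_mono powr_mono2)
        hence "ennreal ((1 - norm w) powr \<beta>) * ennreal (norm (H w * F w) powr p)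
           \<le> ennreal ((1 - norm w) powr \<beta>) * ennreal (B powr p * norm (F w) powr p)"
          by (intro mult_left_mono ennreal_leI) auto
        thus ?thesis using True by (simp add: ennreal_mult mult_ac)
      qed auto
    qed
    also have "\<dots> = ennreal (B powr p) * weighted_integral p \<beta> F"
      unfolding weighted_integral_def
    proof (rule nn_integral_cmult)
      have "(\<lambda>w. indicator (ball 0 1) w * ennreal ((1 - norm w) powr \<beta> * norm (F w) powr p)) \<in> borel_measurable borel"
        by (intro borel_measurable_indicator_times_continuous continuous_intros
            continuous_on_norm_powr[OF holomorphic_vec_on_continuous[OF hF] p]) auto
      thus "(\<lambda>w. indicator (ball 0 1) w * ennreal ((1 - norm w) powr \<beta>) * ennreal (norm (F w) powr p)) \<in> borel_measurable lborel"
        by (simp add: ennreal_mult mult.assoc)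
    qed
    also have "\<dots> < \<infinity>" using F by (simp add: weighted_class_def ennreal_mult_less_top)
    finally show ?thesis .
  qed
  ultimately show ?thesis by (simp add: weighted_class_def)
qed

lemma weighted_class_cmult:
  assumes "weighted_class p \<beta> F" "p > 0"
  shows "weighted_class p \<beta> (\<lambda>z :: complex ^ 'n. c * F z)"
  by (rule weighted_class_mult_bounded[OF assms(1) _ assms(2), where B = "norm c"])
     (auto intro!: holomorphic_vec_onI derivative_eq_intros)

lemma weighted_class_coordinate_mult:
  assumes "weighted_class p \<beta> F" "p > 0"
  shows "weighted_class p \<beta> (\<lambda>z :: complex ^ 'n. z $ k * F z)"
proof (rule weighted_class_mult_bounded[OF assms(1) _ assms(2), where B = 1])
  show "holomorphic_vec_on (\<lambda>z. z $ k) (ball (0 :: complex ^ 'n) 1)"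
    by (rule holomorphic_vec_onI, rule exI[of _ "\<lambda>v. v $ k"])
       (auto intro!: bounded_linear.has_derivative[OF bounded_linear_vec_nth, of "\<lambda>z. z"] derivative_eq_intros)
  show "norm z < 1 \<Longrightarrow> norm (z $ k) \<le> 1" for z :: "complex ^ 'n"
    using Finite_Cartesian_Product.norm_nth_le[of z k] by linarith
qed

lemma weighted_class_sum:
  assumes "finite A" "\<And>k. k \<in> A \<Longrightarrow> weighted_class p \<beta> (F k)" "p > 0"
  shows "weighted_class p \<beta> (\<lambda>z :: complex ^ 'n. \<Sum>k\<in>A. F k z)"
  using assms by (induction A rule: finite_induct) (auto simp: weighted_class_zero intro!: weighted_class_add)

lemma weighted_class_partial_deriv:
  assumes "weighted_class p \<beta> F" "p > 0"
  shows "weighted_class p (\<beta> + p) (partial_deriv k (F :: complex ^ 'n \<Rightarrow> complex))"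
proof -
  have F: "holomorphic_vec_on F (ball 0 1)" using assms by (simp add: weighted_class_def)
  obtain C where C: "C \<ge> 0" "weighted_integral p (\<beta> + p) (partial_deriv k F) \<le> ennreal C * weighted_integral p \<beta> F"
    using weighted_integral_partial_deriv_le[OF assms(2), where 'n = 'n and \<beta> = \<beta>] F by blast
  note C(2)
  also have "ennreal C * weighted_integral p \<beta> F < \<infinity>"
    using assms(1) by (simp add: weighted_class_def ennreal_mult_less_top)
  finally show ?thesis
    using holomorphic_vec_on_partial_deriv[OF F open_ball] by (simp add: weighted_class_def)
qed

section \<open>Commuting partial derivatives past the radial derivative\<close>

text \<open>Shifts $R + c$ appear because each partial derivative that moves past $R$ adds one.\<close>

definition shifted_radial :: "nat \<Rightarrow> (complex ^ 'n \<Rightarrow> complex) \<Rightarrow> complex ^ 'n \<Rightarrow> complex" where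
  "shifted_radial c F = (\<lambda>z. radial_deriv F z + of_nat c * F z)"

lemma shifted_radial_0: "shifted_radial 0 = radial_deriv"
  by (simp add: shifted_radial_def fun_eq_iff)

lemma holomorphic_shifted_radial:
  "holomorphic_vec_on F S \<Longrightarrow> open S \<Longrightarrow> holomorphic_vec_on (shifted_radial c F) S"
  unfolding shifted_radial_def by (rule holomorphic_vec_on_radial)

lemma holomorphic_shifted_radial_funpow:
  "holomorphic_vec_on F S \<Longrightarrow> open S \<Longrightarrow> holomorphic_vec_on ((shifted_radial c ^^ k) F) S"
  by (induction k) (auto intro: holomorphic_shifted_radial)

lemma shifted_radial_cong:
  assumes "open S" "z \<in> S" "\<And>w. w \<in> S \<Longrightarrow> F w = G w"
  shows "shifted_radial c F z = shifted_radial c G z"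
  using partial_deriv_cong[OF assms] assms(3)[OF assms(2)] by (simp add: shifted_radial_def radial_deriv_def)

lemma weighted_class_shifted_radial_cancel:
  assumes "weighted_class p (\<beta> + p) (shifted_radial c F)" "holomorphic_vec_on F (ball (0 :: complex ^ 'n) 1)" "p > 0" "\<beta> > -1"
  shows "weighted_class p \<beta> F"
  using weighted_integral_radial_finite[OF assms(3,4,2), of c] assms(1,2)
  by (simp add: weighted_class_def shifted_radial_def)

lemma weighted_class_shifted_radial_funpow_cancel:
  assumes "weighted_class p (\<beta> + p * real k) ((shifted_radial c ^^ k) F)" "holomorphic_vec_on F (ball (0 :: complex ^ 'n) 1)" "p > 0" "\<beta> > -1"
  shows "weighted_class p \<beta> F"
  using assms(1)
proof (induction k)
  case (Suc k)
  have "0 \<le> p * real k" using assms by simp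
  hence \<beta>': "\<beta> + p * real k > -1" using assms(4) by linarith
  have "weighted_class p (\<beta> + p * real k + p) (shifted_radial c ((shifted_radial c ^^ k) F))"
    using Suc.prems by (simp add: algebra_simps)
  hence "weighted_class p (\<beta> + p * real k) ((shifted_radial c ^^ k) F)"
    by (rule weighted_class_shifted_radial_cancel[OF _ holomorphic_shifted_radial_funpow[OF assms(2) open_ball] assms(3) \<beta>'])
  thus ?case by (rule Suc.IH)
qed simp

lemma holomorphic_foldr_partial_deriv:
  "holomorphic_vec_on F S \<Longrightarrow> open S \<Longrightarrow> holomorphic_vec_on (foldr partial_deriv L F) (S :: (complex ^ 'n) set)"
  by (induction L) (auto intro: holomorphic_vec_on_partial_deriv)

lemma foldr_partial_deriv_cong:
  fixes S :: "(complex ^ 'n) set"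
  assumes "open S" "\<And>w. w \<in> S \<Longrightarrow> F w = G w"
  shows "z \<in> S \<Longrightarrow> foldr partial_deriv L F z = foldr partial_deriv L G z"
  by (induction L arbitrary: z) (auto simp: assms intro!: partial_deriv_cong[OF assms(1)])

lemma weighted_class_foldr_partial_deriv:
  assumes "weighted_class p \<beta> F" "p > 0"
  shows "weighted_class p (\<beta> + p * real (length L)) (foldr partial_deriv L (F :: complex ^ 'n \<Rightarrow> complex))"
proof (induction L)
  case (Cons k L)
  from weighted_class_partial_deriv[OF Cons assms(2), of k] show ?case
    by (simp add: algebra_simps)
qed (use assms in simp)

lemma foldr_partial_deriv_shifted_radial:
  fixes F :: "complex ^ 'n \<Rightarrow> complex"
  assumes F: "holomorphic_vec_on F S" "open S"
  shows "z \<in> S \<Longrightarrow> foldr partial_deriv L (shifted_radial c F) z = shifted_radial (c + length L) (foldr partial_deriv L F) z"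
proof (induction L arbitrary: z)
  case (Cons k L)
  have "foldr partial_deriv (k # L) (shifted_radial c F) z = partial_deriv k (shifted_radial (c + length L) (foldr partial_deriv L F)) z"
    by simp (rule partial_deriv_cong[OF F(2) Cons.prems Cons.IH])
  also have "\<dots> = shifted_radial (c + length (k # L)) (foldr partial_deriv (k # L) F) z"
    unfolding shifted_radial_def using Cons.prems
    by (subst partial_deriv_radial[OF holomorphic_foldr_partial_deriv[OF F] F(2)]) auto
  finally show ?case .
qed simp

lemma foldr_partial_deriv_radial_funpow:
  fixes F :: "complex ^ 'n \<Rightarrow> complex"
  assumes F: "holomorphic_vec_on F S" "open S"
  shows "z \<in> S \<Longrightarrow> foldr partial_deriv L ((radial_deriv ^^ k) F) z = (shifted_radial (length L) ^^ k) (foldr partial_deriv L F) z"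
proof (induction k arbitrary: z)
  case (Suc k)
  have "foldr partial_deriv L ((radial_deriv ^^ Suc k) F) z = foldr partial_deriv L (shifted_radial 0 ((radial_deriv ^^ k) F)) z"
    by (simp add: shifted_radial_0)
  also have "\<dots> = shifted_radial (length L) (foldr partial_deriv L ((radial_deriv ^^ k) F)) z"
    using holomorphic_shifted_radial_funpow[OF F, where c = 0 and k = k] F(2) Suc.prems
    by (subst foldr_partial_deriv_shifted_radial) (auto simp: shifted_radial_0)
  also have "\<dots> = shifted_radial (length L) ((shifted_radial (length L) ^^ k) (foldr partial_deriv L F)) z"
    by (rule shifted_radial_cong[OF F(2) Suc.prems Suc.IH])
  finally show ?case by simp
qed simp

text \<open>Derivatives are indexed by the list of variables in which they are taken.  Prepending a variable to
a list is one more differentiation on the outside, so inductions on the order need no commutation of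
partial derivatives; the passage to multi-indices is made only once, at the end.\<close>

definition derivs_in_class :: "real \<Rightarrow> nat \<Rightarrow> real \<Rightarrow> (complex ^ 'n \<Rightarrow> complex) \<Rightarrow> bool" where
  "derivs_in_class p k \<beta> F \<longleftrightarrow> (\<forall>L. length L = k \<longrightarrow> weighted_class p \<beta> (foldr partial_deriv L F))"

lemma derivs_in_class_Suc:
  assumes "derivs_in_class p k \<beta> (F :: complex ^ 'n \<Rightarrow> complex)" "p > 0"
  shows "derivs_in_class p (Suc k) (\<beta> + p) F"
  unfolding derivs_in_class_def
proof (intro allI impI)
  fix L :: "'n list" assume "length L = Suc k"
  then obtain j L' where L: "L = j # L'" "length L' = k" by (cases L) auto
  have "weighted_class p \<beta> (foldr partial_deriv L' F)"
    using assms(1) L by (simp add: derivs_in_class_def)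
  from weighted_class_partial_deriv[OF this assms(2), of j]
  show "weighted_class p (\<beta> + p) (foldr partial_deriv L F)"
    by (simp add: L)
qed

text \<open>The coefficients $z_j$ of the radial derivative are bounded by one on the ball.\<close>

lemma weighted_class_radial_deriv:
  assumes "\<And>j. weighted_class p \<beta> (partial_deriv j F)" "p > 0"
  shows "weighted_class p \<beta> (radial_deriv (F :: complex ^ 'n \<Rightarrow> complex))"
  unfolding radial_deriv_def[abs_def]
  by (intro weighted_class_sum weighted_class_coordinate_mult assms) auto

lemma derivs_in_class_Suc_cancel:
  assumes "derivs_in_class p (Suc k) (\<beta> + p) (F :: complex ^ 'n \<Rightarrow> complex)" "p > 0" "\<beta> > -1" "holomorphic_vec_on F (ball 0 1)"
  shows "derivs_in_class p k \<beta> F"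
  unfolding derivs_in_class_def
proof (intro allI impI)
  fix L :: "'n list" assume L: "length L = k"
  have "weighted_class p (\<beta> + p) (partial_deriv j (foldr partial_deriv L F))" for j
    using assms(1) L by (auto simp: derivs_in_class_def dest!: spec[of _ "j # L"])
  hence "weighted_class p (\<beta> + p) (shifted_radial 0 (foldr partial_deriv L F))"
    unfolding shifted_radial_0 by (intro weighted_class_radial_deriv assms)
  thus "weighted_class p \<beta> (foldr partial_deriv L F)"
    by (rule weighted_class_shifted_radial_cancel) (auto intro: assms holomorphic_foldr_partial_deriv)
qed

lemma derivs_in_class_shift_order:
  assumes p: "p > 0" and F: "holomorphic_vec_on F (ball 0 1)" and kl: "k \<le> l" and k: "\<alpha> + p * real k > -1"
  shows "derivs_in_class p k (\<alpha> + p * real k) (F :: complex ^ 'n \<Rightarrow> complex) \<longleftrightarrow> derivs_in_class p l (\<alpha> + p * real l) F"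
  using kl
proof (induction l rule: dec_induct)
  case (step l)
  have "p * real k \<le> p * real l" using step p by simp
  hence "\<alpha> + p * real l > -1" using k by linarith
  hence "derivs_in_class p l (\<alpha> + p * real l) F \<longleftrightarrow> derivs_in_class p (Suc l) (\<alpha> + p * real l + p) F"
    using derivs_in_class_Suc derivs_in_class_Suc_cancel p F by blast
  thus ?case using step.IH by (simp add: algebra_simps)
qed simp

text \<open>Passing from order $j+1$ to order $j$ gains a power $\delta^p$, which is given away again here; so the
exponent stays put and remains above $-1$, which each step requires.\<close>

lemma derivs_in_class_lower_order:
  assumes "derivs_in_class p k \<beta> (F :: complex ^ 'n \<Rightarrow> complex)" and p: "p > 0" and \<beta>: "\<beta> > -1"
    and F: "holomorphic_vec_on F (ball 0 1)" and "j \<le> k"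
  shows "derivs_in_class p j \<beta> F"
  using \<open>j \<le> k\<close>
proof (induction j rule: inc_induct)
  case (step j)
  have "derivs_in_class p (Suc j) (\<beta> + p) F"
    using step.IH p by (auto simp: derivs_in_class_def intro: weighted_class_mono_exponent[where \<beta> = \<beta>])
  thus ?case by (rule derivs_in_class_Suc_cancel[OF _ p \<beta> F])
qed (use assms in simp)

text \<open>Differentiating $R^k F$ another $k$ times raises the exponent by $pk$, and the identity
$\partial R^k F = (R + k)^k \partial F$ then allows the radial derivatives to be removed, which brings the
exponent back to $\beta$.\<close>

lemma derivs_in_class_of_radial_funpow:
  assumes p: "p > 0" and \<beta>: "\<beta> > -1" and F: "holomorphic_vec_on F (ball 0 1)"
    and R: "weighted_class p \<beta> ((radial_deriv ^^ k) (F :: complex ^ 'n \<Rightarrow> complex))"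
  shows "derivs_in_class p k \<beta> F"
  unfolding derivs_in_class_def
proof (intro allI impI)
  fix L :: "'n list" assume L: "length L = k"
  have "weighted_class p (\<beta> + p * real k) (foldr partial_deriv L ((radial_deriv ^^ k) F))"
    using weighted_class_foldr_partial_deriv[OF R p, of L] L by simp
  hence "weighted_class p (\<beta> + p * real k) ((shifted_radial k ^^ k) (foldr partial_deriv L F))"
    by (rule weighted_class_cong) (use foldr_partial_deriv_radial_funpow[OF F open_ball] L in auto)
  thus "weighted_class p \<beta> (foldr partial_deriv L F)"
    by (rule weighted_class_shifted_radial_funpow_cancel) (auto intro: p \<beta> F holomorphic_foldr_partial_deriv)
qed

text \<open>The induction replaces $F$ by $RF$: by the commutation rule, derivatives of $RF$ of order at most $k$
are combinations, with bounded coefficients, of derivatives of $F$ of order at most $k + 1$.\<close>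

lemma radial_funpow_in_class:
  assumes p: "p > 0"
  shows "holomorphic_vec_on F (ball 0 1) \<Longrightarrow> (\<And>j. j \<le> k \<Longrightarrow> derivs_in_class p j \<beta> F)
    \<Longrightarrow> weighted_class p \<beta> ((radial_deriv ^^ k) (F :: complex ^ 'n \<Rightarrow> complex))"
proof (induction k arbitrary: F)
  case 0
  from 0(2)[of 0] show ?case by (auto simp: derivs_in_class_def)
next
  case (Suc k)
  note F = Suc.prems(1)
  have hRF: "holomorphic_vec_on (radial_deriv F) (ball 0 1)"
    using holomorphic_shifted_radial[OF F, of 0] by (simp add: shifted_radial_0)
  have "derivs_in_class p j \<beta> (radial_deriv F)" if j: "j \<le> k" for j
    unfolding derivs_in_class_def
  proof (intro allI impI)
    fix L :: "'n list" assume L: "length L = j"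
    have 1: "weighted_class p \<beta> (partial_deriv i (foldr partial_deriv L F))" for i
      using Suc.prems(2)[of "Suc j"] j L by (auto simp: derivs_in_class_def dest!: spec[of _ "i # L"])
    have 2: "weighted_class p \<beta> (foldr partial_deriv L F)"
      using Suc.prems(2)[of j] j L by (auto simp: derivs_in_class_def)
    have "weighted_class p \<beta> (shifted_radial (0 + j) (foldr partial_deriv L F))"
      unfolding shifted_radial_def
      by (intro weighted_class_add weighted_class_radial_deriv weighted_class_cmult 1 2 p)
    thus "weighted_class p \<beta> (foldr partial_deriv L (radial_deriv F))"
      by (rule weighted_class_cong)
         (use foldr_partial_deriv_shifted_radial[OF F open_ball, of _ L 0] L in \<open>auto simp: shifted_radial_0\<close>)
  qed
  from Suc.IH[OF hRF this] show ?case by (simp add: funpow_swap1)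
qed

lemma radial_funpow_in_class_iff:
  assumes p: "p > 0" and \<beta>: "\<beta> > -1" and F: "holomorphic_vec_on F (ball 0 1)"
  shows "weighted_class p \<beta> ((radial_deriv ^^ k) (F :: complex ^ 'n \<Rightarrow> complex)) \<longleftrightarrow> derivs_in_class p k \<beta> F"
proof
  assume D: "derivs_in_class p k \<beta> F"
  show "weighted_class p \<beta> ((radial_deriv ^^ k) F)"
    using derivs_in_class_lower_order[OF D p \<beta> F] by (intro radial_funpow_in_class[OF p F])
qed (rule derivs_in_class_of_radial_funpow[OF p \<beta> F])

section \<open>Multi-indices and lists of variables\<close>

lemma foldr_partial_deriv_funpow:
  "foldr (\<lambda>k. partial_deriv k ^^ m k) xs F = foldr partial_deriv (concat (map (\<lambda>k. replicate (m k) k) xs)) F"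
proof (induction xs)
  case (Cons k xs)
  have "foldr partial_deriv (replicate n k) G = (partial_deriv k ^^ n) G" for n and G :: "complex ^ 'a \<Rightarrow> complex"
    by (induction n) auto
  thus ?case using Cons by simp
qed simp

lemma multi_deriv_eq_foldr:
  fixes m :: "'n::{finite,linorder} \<Rightarrow> nat"
  obtains L where "length L = multi_abs m" "\<And>F. multi_deriv m F = foldr partial_deriv L F"
proof
  let ?xs = "sorted_list_of_set (UNIV :: 'n set)"
  show "length (concat (map (\<lambda>k. replicate (m k) k) ?xs)) = multi_abs m"
    by (simp add: length_concat multi_abs_def comp_def sum_list_distinct_conv_sum_set)
  show "multi_deriv m F = foldr partial_deriv (concat (map (\<lambda>k. replicate (m k) k) ?xs)) F" for F
    unfolding multi_deriv_def by (rule foldr_partial_deriv_funpow)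
qed

lemma partial_deriv_foldr_commute:
  fixes F :: "complex ^ 'n \<Rightarrow> complex"
  assumes F: "holomorphic_vec_on F S" "open S"
  shows "z \<in> S \<Longrightarrow> partial_deriv j (foldr partial_deriv L F) z = foldr partial_deriv L (partial_deriv j F) z"
proof (induction L arbitrary: z)
  case (Cons k L)
  have "partial_deriv j (foldr partial_deriv (k # L) F) z = partial_deriv k (partial_deriv j (foldr partial_deriv L F)) z"
    using partial_deriv_commute[OF holomorphic_foldr_partial_deriv[OF F] F(2) Cons.prems] by simp
  also have "\<dots> = foldr partial_deriv (k # L) (partial_deriv j F) z"
    by simp (rule partial_deriv_cong[OF F(2) Cons.prems Cons.IH])
  finally show ?case .
qed simp

text \<open>In a multi-index derivative the variables come in a fixed order, so a further $\partial_j$ has to be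
moved inwards to the block of its own variable.\<close>

lemma partial_deriv_multi_deriv:
  fixes F :: "complex ^ 'n::{finite,linorder} \<Rightarrow> complex"
  assumes F: "holomorphic_vec_on F S" "open S" and z: "z \<in> S"
  shows "partial_deriv j (multi_deriv m F) z = multi_deriv (m(j := Suc (m j))) F z"
proof -
  define m' where "m' = m(j := Suc (m j))"
  define L where "L = (\<lambda>m xs. concat (map (\<lambda>k. replicate (m k) k) xs) :: 'n list)"
  have "partial_deriv j (foldr partial_deriv (L m xs) F) z = foldr partial_deriv (L m' xs) F z"
    if "distinct xs" "j \<in> set xs" "z \<in> S" for xs z
    using that
  proof (induction xs arbitrary: z)
    case (Cons k xs)
    let ?G = "\<lambda>m. foldr partial_deriv (L m xs) F"
    have L_Cons: "foldr partial_deriv (L m (k # xs)) F = foldr partial_deriv (replicate (m k) k) (?G m)" for m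
      by (simp add: L_def)
    show ?case
    proof (cases "k = j")
      case True
      hence mk: "L m' xs = L m xs" "m' k = Suc (m k)"
        using Cons.prems by (auto simp: L_def m'_def intro!: arg_cong[where f = concat])
      show ?thesis unfolding L_Cons mk by (simp add: True)
    next
      case False
      have "partial_deriv j (foldr partial_deriv (L m (k # xs)) F) z
          = foldr partial_deriv (replicate (m k) k) (partial_deriv j (?G m)) z"
        unfolding L_Cons
        by (rule partial_deriv_foldr_commute[OF holomorphic_foldr_partial_deriv[OF F] F(2) Cons.prems(3)])
      also have "\<dots> = foldr partial_deriv (replicate (m k) k) (?G m') z"
        using Cons.prems False by (intro foldr_partial_deriv_cong[OF F(2)] Cons.IH) auto
      also have "\<dots> = foldr partial_deriv (L m' (k # xs)) F z"
        using False by (simp add: L_Cons m'_def)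
      finally show ?thesis .
    qed
  qed simp
  from this[of "sorted_list_of_set UNIV" z] z show ?thesis
    unfolding multi_deriv_def foldr_partial_deriv_funpow L_def m'_def by simp
qed

lemma foldr_eq_multi_deriv:
  fixes F :: "complex ^ 'n::{finite,linorder} \<Rightarrow> complex"
  assumes F: "holomorphic_vec_on F S" "open S"
  shows "\<exists>m. multi_abs m = length L \<and> (\<forall>z\<in>S. foldr partial_deriv L F z = multi_deriv m F z)"
proof (induction L)
  case Nil
  have "foldr (\<lambda>k. id) xs F = F" for xs :: "'n list" by (induction xs) auto
  thus ?case by (intro exI[of _ "\<lambda>_. 0"]) (simp add: multi_abs_def multi_deriv_def)
next
  case (Cons j L)
  then obtain m where m: "multi_abs m = length L" "\<And>z. z \<in> S \<Longrightarrow> foldr partial_deriv L F z = multi_deriv m F z"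
    by blast
  have "multi_abs (m(j := Suc (m j))) = Suc (multi_abs m)"
    by (simp add: multi_abs_def sum.remove[of UNIV j])
  moreover have "foldr partial_deriv (j # L) F z = multi_deriv (m(j := Suc (m j))) F z" if "z \<in> S" for z
    using partial_deriv_cong[OF F(2) that m(2), where k = j] partial_deriv_multi_deriv[OF F that, of j m] by simp
  ultimately show ?case
    using m(1) by (intro exI[of _ "m(j := Suc (m j))"]) (simp del: fun_upd_apply)
qed

lemma derivs_in_class_iff_multi_deriv:
  fixes F :: "complex ^ 'n::{finite,linorder} \<Rightarrow> complex"
  assumes F: "holomorphic_vec_on F (ball 0 1)"
  shows "derivs_in_class p k \<beta> F \<longleftrightarrow> (\<forall>m. multi_abs m = k \<longrightarrow> weighted_class p \<beta> (multi_deriv m F))"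
proof (intro iffI allI impI)
  fix m :: "'n \<Rightarrow> nat"
  assume D: "derivs_in_class p k \<beta> F" and m: "multi_abs m = k"
  obtain L where "length L = multi_abs m" "multi_deriv m F = foldr partial_deriv L F"
    using multi_deriv_eq_foldr[of m] by metis
  thus "weighted_class p \<beta> (multi_deriv m F)"
    using D m by (simp add: derivs_in_class_def)
next
  assume D: "\<forall>m. multi_abs m = k \<longrightarrow> weighted_class p \<beta> (multi_deriv m F)"
  show "derivs_in_class p k \<beta> F"
    unfolding derivs_in_class_def
  proof (intro allI impI)
    fix L :: "'n list" assume L: "length L = k"
    obtain m where m: "multi_abs m = length L" "\<And>z. z \<in> ball 0 1 \<Longrightarrow> foldr partial_deriv L F z = multi_deriv m F z"
      using foldr_eq_multi_deriv[OF F open_ball, of L] by blast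
    have "weighted_class p \<beta> (multi_deriv m F)" using D m L by simp
    thus "weighted_class p \<beta> (foldr partial_deriv L F)"
      by (rule weighted_class_cong) (simp add: m)
  qed
qed

section \<open>Membership in the weighted Lebesgue spaces\<close>

lemma ball_weight_comparable:
  fixes z :: "'a::real_normed_vector"
  assumes "norm z < 1"
  shows "(1 - (norm z)\<^sup>2) powr s \<le> 2 powr \<bar>s\<bar> * (1 - norm z) powr s"
    and "(1 - norm z) powr s \<le> 2 powr \<bar>s\<bar> * (1 - (norm z)\<^sup>2) powr s"
proof -
  have eq: "1 - (norm z)\<^sup>2 = (1 + norm z) * (1 - norm z)"
    by (simp add: power2_eq_square algebra_simps)
  have "0 < 1 - norm z" using assms by simp
  have pos: "0 < 1 - (norm z)\<^sup>2"
    unfolding eq using assms by (intro mult_pos_pos) (auto simp: add_pos_nonneg)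
  have ub: "1 - (norm z)\<^sup>2 \<le> 2 * (1 - norm z)"
    unfolding eq using assms by (intro mult_right_mono) auto
  have "1 * (1 - norm z) \<le> (1 + norm z) * (1 - norm z)"
    using assms by (intro mult_right_mono) auto
  moreover define r where "r = 1 - (norm z)\<^sup>2"
  ultimately have "1 - norm z \<le> r" "r > 0"
    using pos by (auto simp flip: eq)
  hence lb: "1 - norm z \<le> 2 * (1 - (norm z)\<^sup>2)"
    unfolding r_def[symmetric] by linarith
  show "(1 - (norm z)\<^sup>2) powr s \<le> 2 powr \<bar>s\<bar> * (1 - norm z) powr s"
    using pos \<open>0 < 1 - norm z\<close> ub lb by (intro powr_comparable) auto
  show "(1 - norm z) powr s \<le> 2 powr \<bar>s\<bar> * (1 - (norm z)\<^sup>2) powr s"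
    using pos \<open>0 < 1 - norm z\<close> ub lb by (intro powr_comparable) auto
qed

lemma weighted_integral_finite_iff:
  fixes F :: "complex ^ 'n \<Rightarrow> complex"
  assumes p: "p > 0" and F: "continuous_on (ball 0 1) F"
  shows "weighted_integral p \<beta> F < \<infinity> \<longleftrightarrow>
     (\<integral>\<^sup>+w. indicator (ball 0 1) w * ennreal ((1 - (norm w)\<^sup>2) powr \<beta> * norm (F w) powr p) \<partial>lborel) < \<infinity>"
    (is "_ \<longleftrightarrow> ?I < _")
proof -
  let ?c = "ennreal (2 powr \<bar>\<beta>\<bar>)"
  have pos: "0 < 1 - (norm w)\<^sup>2" if "w \<in> ball 0 1" for w :: "complex ^ 'n"
    using that by (simp add: abs_square_less_1)
  have W: "weighted_integral p \<beta> F = (\<integral>\<^sup>+w. indicator (ball 0 1) w * ennreal ((1 - norm w) powr \<beta> * norm (F w) powr p) \<partial>lborel)"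
    by (simp add: weighted_integral_def ennreal_mult mult.assoc)
  have m1: "(\<lambda>w. indicator (ball 0 1) w * ennreal ((1 - norm w) powr \<beta> * norm (F w) powr p)) \<in> borel_measurable lborel"
    unfolding measurable_lborel2
    by (intro borel_measurable_indicator_times_continuous continuous_intros continuous_on_norm_powr[OF F p]) auto
  have m2: "(\<lambda>w. indicator (ball 0 1) w * ennreal ((1 - (norm w)\<^sup>2) powr \<beta> * norm (F w) powr p)) \<in> borel_measurable lborel"
    unfolding measurable_lborel2 using pos
    by (intro borel_measurable_indicator_times_continuous continuous_intros continuous_on_norm_powr[OF F p]) force+
  have "?I \<le> (\<integral>\<^sup>+w. ?c * (indicator (ball 0 1) w * ennreal ((1 - norm w) powr \<beta> * norm (F w) powr p)) \<partial>lborel)"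
  proof (rule nn_integral_mono)
    fix w :: "complex ^ 'n"
    show "indicator (ball 0 1) w * ennreal ((1 - (norm w)\<^sup>2) powr \<beta> * norm (F w) powr p)
       \<le> ?c * (indicator (ball 0 1) w * ennreal ((1 - norm w) powr \<beta> * norm (F w) powr p))"
    proof (cases "norm w < 1")
      case True
      from mult_right_mono[OF ball_weight_comparable(1)[OF True, of \<beta>], of "norm (F w) powr p"]
      show ?thesis using True by (simp add: mult.assoc ennreal_leI flip: ennreal_mult)
    qed auto
  qed
  also have "\<dots> = ?c * weighted_integral p \<beta> F"
    unfolding W by (rule nn_integral_cmult[OF m1])
  finally have 1: "?I \<le> ?c * weighted_integral p \<beta> F" .
  have "weighted_integral p \<beta> F \<le> (\<integral>\<^sup>+w. ?c * (indicator (ball 0 1) w * ennreal ((1 - (norm w)\<^sup>2) powr \<beta> * norm (F w) powr p)) \<partial>lborel)"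
    unfolding W
  proof (rule nn_integral_mono)
    fix w :: "complex ^ 'n"
    show "indicator (ball 0 1) w * ennreal ((1 - norm w) powr \<beta> * norm (F w) powr p)
       \<le> ?c * (indicator (ball 0 1) w * ennreal ((1 - (norm w)\<^sup>2) powr \<beta> * norm (F w) powr p))"
    proof (cases "norm w < 1")
      case True
      from mult_right_mono[OF ball_weight_comparable(2)[OF True, of \<beta>], of "norm (F w) powr p"]
      show ?thesis using True by (simp add: mult.assoc ennreal_leI flip: ennreal_mult)
    qed auto
  qed
  also have "\<dots> = ?c * ?I"
    by (rule nn_integral_cmult[OF m2])
  finally have 2: "weighted_integral p \<beta> F \<le> ?c * ?I" .
  show ?thesis
  proof
    assume "weighted_integral p \<beta> F < \<infinity>"
    hence "?c * weighted_integral p \<beta> F < \<infinity>" by (simp add: ennreal_mult_less_top)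
    with 1 show "?I < \<infinity>" by (rule le_less_trans)
  next
    assume "?I < \<infinity>"
    hence "?c * ?I < \<infinity>" by (simp add: ennreal_mult_less_top)
    with 2 show "weighted_integral p \<beta> F < \<infinity>" by (rule le_less_trans)
  qed
qed

text \<open>For $\alpha > -1$ the normalising integral is finite because the constant function $1$ has radial
derivative $0$, which lies in every class, so that the Hardy inequality puts $1$ in $A_\alpha$.
This matters since a divergent integral has the default value $0$.\<close>

lemma weight_const_pos: "weight_const TYPE('n::finite) \<alpha> > 0"
proof (cases "\<alpha> > -1")
  case True
  define h where "h = (\<lambda>z :: complex ^ 'n. indicator (ball 0 1) z *\<^sub>R (1 - (norm z)\<^sup>2) powr \<alpha>)"
  have pos: "0 < 1 - (norm w)\<^sup>2" if "w \<in> ball 0 1" for w :: "complex ^ 'n"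
    using that by (simp add: abs_square_less_1)
  have h_meas: "h \<in> borel_measurable borel"
    unfolding h_def using pos
    by (intro borel_measurable_continuous_on_indicator continuous_intros) force+
  have h_nonneg: "0 \<le> h z" for z by (simp add: h_def)
  have hol: "holomorphic_vec_on (\<lambda>_ :: complex ^ 'n. 1) (ball 0 1)"
    by (auto intro!: holomorphic_vec_onI derivative_eq_intros)
  have radial: "(\<lambda>z :: complex ^ 'n. radial_deriv (\<lambda>_. 1) z + of_nat 0 * 1) = (\<lambda>_. 0)"
    by (simp add: radial_deriv_def partial_deriv_def)
  have "weighted_integral 1 \<alpha> (\<lambda>_ :: complex ^ 'n. 1) < \<infinity>"
  proof (rule weighted_integral_radial_finite[OF zero_less_one True hol])
    show "weighted_integral 1 (\<alpha> + 1) (\<lambda>z :: complex ^ 'n. radial_deriv (\<lambda>_. 1) z + of_nat 0 * 1) < \<infinity>"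
      unfolding radial weighted_integral_def by simp
  qed
  hence "(\<integral>\<^sup>+w. indicator (ball (0::complex ^ 'n) 1) w * ennreal ((1 - (norm w)\<^sup>2) powr \<alpha> * norm (1::complex) powr 1) \<partial>lborel) < \<infinity>"
    by (subst (asm) weighted_integral_finite_iff) auto
  also have "(\<integral>\<^sup>+w. indicator (ball (0::complex ^ 'n) 1) w * ennreal ((1 - (norm w)\<^sup>2) powr \<alpha> * norm (1::complex) powr 1) \<partial>lborel) = (\<integral>\<^sup>+w. ennreal (h w) \<partial>lborel)"
    by (intro nn_integral_cong) (auto simp: h_def indicator_def)
  finally have int: "integrable lborel h"
    using h_meas h_nonneg by (intro integrableI_nonneg) auto
  have "(\<integral>z. h z \<partial>lborel) \<noteq> 0"
  proof
    assume "(\<integral>z. h z \<partial>lborel) = 0"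
    hence "AE z in lborel. h z = 0"
      using integral_nonneg_eq_0_iff_AE[OF int] h_nonneg by simp
    hence "AE z in lborel. z \<notin> ball (0 :: complex ^ 'n) 1"
      by eventually_elim (use pos in \<open>force simp: h_def\<close>)
    hence "ball (0 :: complex ^ 'n) 1 \<in> null_sets lborel"
      by (subst AE_iff_null_sets) auto
    hence "emeasure lborel (ball (0 :: complex ^ 'n) 1) = 0"
      by (rule null_setsD1)
    hence "ennreal (unit_ball_vol DIM(complex ^ 'n)) = 0"
      using emeasure_ball[of 1 "0 :: complex ^ 'n"] by simp
    moreover have "unit_ball_vol DIM(complex ^ 'n) > 0" by simp
    ultimately show False by (metis ennreal_eq_0_iff not_le)
  qed
  moreover have "(\<integral>z. h z \<partial>lborel) \<ge> 0" using h_nonneg by simp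
  ultimately show ?thesis
    using True by (simp add: weight_const_def set_lebesgue_integral_def h_def less_le)
qed (simp add: weight_const_def)

text \<open>The factor $(1 - |z|^2)^k$ inside the $p$-th power is absorbed by the weight and raises its exponent by
$pk$.\<close>

lemma Lp_weighted_volume_iff:
  fixes F :: "complex ^ 'n \<Rightarrow> complex"
  assumes p: "p > 0" and F: "continuous_on (ball 0 1) F"
  shows "(\<lambda>z. of_real ((1 - (norm z)\<^sup>2) ^ k) * F z) \<in> Lp p (weighted_volume \<alpha>) \<longleftrightarrow>
           weighted_integral p (\<alpha> + p * real k) F < \<infinity>"
proof -
  define c where "c = weight_const TYPE('n) \<alpha>"
  have c: "c > 0" unfolding c_def by (rule weight_const_pos)
  define g where "g = (\<lambda>z. of_real ((1 - (norm z)\<^sup>2) ^ k) * F z)"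
  define M where "M = restrict_space lborel (ball (0 :: complex ^ 'n) 1)"
  define \<omega> where "\<omega> = (\<lambda>z :: complex ^ 'n. ennreal (c * (1 - (norm z)\<^sup>2) powr \<alpha>))"
  have pos: "0 < 1 - (norm w)\<^sup>2" if "w \<in> ball 0 1" for w :: "complex ^ 'n"
    using that by (simp add: abs_square_less_1)
  have WV: "weighted_volume \<alpha> = density M \<omega>"
    by (simp add: weighted_volume_def M_def \<omega>_def c_def)
  have setsM: "sets M = sets (restrict_space borel (ball 0 1))"
    unfolding M_def by (rule sets_restrict_space_cong) simp
  have \<omega>_meas: "\<omega> \<in> borel_measurable M"
    unfolding \<omega>_def M_def by (intro measurable_restrict_space1) measurable
  have g_cont: "continuous_on (ball 0 1) g"
    unfolding g_def by (intro continuous_intros F)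
  have g_meas: "g \<in> borel_measurable M"
    using borel_measurable_continuous_on_restrict[OF g_cont] measurable_cong_sets[OF setsM refl] by blast
  have gp_meas: "(\<lambda>z. norm (g z) powr p) \<in> borel_measurable M"
    using g_meas by measurable
  have "g \<in> Lp p (weighted_volume \<alpha>) \<longleftrightarrow> (\<integral>\<^sup>+z. ennreal (norm (g z) powr p) \<partial>density M \<omega>) < \<infinity>"
    using g_meas gp_meas by (simp add: Lp_def WV integrable_iff_bounded)
  also have "(\<integral>\<^sup>+z. ennreal (norm (g z) powr p) \<partial>density M \<omega>) = (\<integral>\<^sup>+z. \<omega> z * ennreal (norm (g z) powr p) \<partial>M)"
    using \<omega>_meas gp_meas by (intro nn_integral_density) auto
  also have "\<dots> = (\<integral>\<^sup>+z. \<omega> z * ennreal (norm (g z) powr p) * indicator (ball 0 1) z \<partial>lborel)"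
    unfolding M_def by (rule nn_integral_restrict_space) simp
  also have "\<dots> = (\<integral>\<^sup>+z. ennreal c * (indicator (ball 0 1) z * ennreal ((1 - (norm z)\<^sup>2) powr (\<alpha> + p * real k) * norm (F z) powr p)) \<partial>lborel)"
  proof (intro nn_integral_cong)
    fix z :: "complex ^ 'n"
    show "\<omega> z * ennreal (norm (g z) powr p) * indicator (ball 0 1) z =
      ennreal c * (indicator (ball 0 1) z * ennreal ((1 - (norm z)\<^sup>2) powr (\<alpha> + p * real k) * norm (F z) powr p))"
    proof (cases "z \<in> ball 0 1")
      case True
      define r where "r = 1 - (norm z)\<^sup>2"
      have r: "r > 0" using pos[OF True] by (simp add: r_def)
      have "norm (g z) = r ^ k * norm (F z)"
      proof -
        have "g z = of_real (r ^ k) * F z" by (simp only: g_def r_def)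
        thus ?thesis using r by (simp only: norm_mult norm_of_real abs_of_nonneg zero_le_power less_imp_le)
      qed
      hence "norm (g z) powr p = r powr (p * real k) * norm (F z) powr p"
      proof -
        have "(r ^ k) powr p = r powr (p * real k)"
          using r by (simp add: powr_powr mult.commute flip: powr_realpow)
        thus ?thesis using r \<open>norm (g z) = r ^ k * norm (F z)\<close> by (simp add: powr_mult)
      qed
      hence "c * r powr \<alpha> * norm (g z) powr p = c * (r powr (\<alpha> + p * real k) * norm (F z) powr p)"
        by (simp add: powr_add)
      hence "ennreal (c * r powr \<alpha>) * ennreal (norm (g z) powr p) = ennreal c * ennreal (r powr (\<alpha> + p * real k) * norm (F z) powr p)"
        using c by (simp flip: ennreal_mult)
      thus ?thesis using True by (simp add: \<omega>_def r_def)
    qed auto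
  qed
  also have "\<dots> = ennreal c * (\<integral>\<^sup>+z. indicator (ball 0 1) z * ennreal ((1 - (norm z)\<^sup>2) powr (\<alpha> + p * real k) * norm (F z) powr p) \<partial>lborel)"
    using pos unfolding measurable_lborel2
    by (intro nn_integral_cmult, unfold measurable_lborel2,
        intro borel_measurable_indicator_times_continuous continuous_intros continuous_on_norm_powr[OF F p]) force+
  also have "\<dots> < \<infinity> \<longleftrightarrow> weighted_integral p (\<alpha> + p * real k) F < \<infinity>"
    using c by (subst weighted_integral_finite_iff[OF p F]) (auto simp: ennreal_mult_less_top)
  finally show ?thesis unfolding g_def .
qed

section \<open>The derivative characterisations of the Bergman spaces\<close>

theorem theorem13:
  fixes p \<alpha> :: real and f :: "complex ^ 'n::{finite,linorder} \<Rightarrow> complex"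
  assumes "p > 0" and "holomorphic_vec_on f (ball 0 1)"
  shows "(f \<in> bergman_space p \<alpha> \<longleftrightarrow>
            (\<exists>k::nat. real k * p + \<alpha> > -1 \<and>
               (\<forall>m. multi_abs m = k \<longrightarrow>
                  (\<lambda>z. of_real ((1 - (norm z)\<^sup>2) ^ multi_abs m) * multi_deriv m f z)
                    \<in> Lp p (weighted_volume \<alpha>)))) \<and>
         (f \<in> bergman_space p \<alpha> \<longleftrightarrow>
            (\<forall>k::nat. real k * p + \<alpha> > -1 \<longrightarrow>
               (\<forall>m. multi_abs m = k \<longrightarrow>
                  (\<lambda>z. of_real ((1 - (norm z)\<^sup>2) ^ multi_abs m) * multi_deriv m f z)
                    \<in> Lp p (weighted_volume \<alpha>))))"
proof -
  note p = assms(1) and f = assms(2)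
  define D where "D = (\<lambda>k. derivs_in_class p k (\<alpha> + p * real k) f)"
  have Lp_iff: "(\<lambda>z. of_real ((1 - (norm z)\<^sup>2) ^ k) * F z) \<in> Lp p (weighted_volume \<alpha>)
      \<longleftrightarrow> weighted_class p (\<alpha> + p * real k) F" if "holomorphic_vec_on F (ball 0 1)" for k and F :: "complex ^ 'n::{finite,linorder} \<Rightarrow> complex"
    using that by (subst Lp_weighted_volume_iff[OF p]) (auto simp: weighted_class_def intro: holomorphic_vec_on_continuous)
  have hol_m: "holomorphic_vec_on (multi_deriv m f) (ball 0 1)" for m
    using multi_deriv_eq_foldr[of m] holomorphic_foldr_partial_deriv[OF f open_ball] by metis
  have multi: "(\<forall>m. multi_abs m = k \<longrightarrow>
      (\<lambda>z. of_real ((1 - (norm z)\<^sup>2) ^ multi_abs m) * multi_deriv m f z) \<in> Lp p (weighted_volume \<alpha>)) \<longleftrightarrow> D k" for k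
    unfolding D_def derivs_in_class_iff_multi_deriv[OF f] using Lp_iff[OF hol_m] by auto
  have radial: "(\<lambda>z. of_real ((1 - (norm z)\<^sup>2) ^ k) * (radial_deriv ^^ k) f z) \<in> Lp p (weighted_volume \<alpha>) \<longleftrightarrow> D k"
    if "real k * p + \<alpha> > -1" for k
  proof -
    have "holomorphic_vec_on ((radial_deriv ^^ k) f) (ball 0 1)"
      using holomorphic_shifted_radial_funpow[OF f open_ball, where c = 0 and k = k] by (simp add: shifted_radial_0)
    hence "(\<lambda>z. of_real ((1 - (norm z)\<^sup>2) ^ k) * (radial_deriv ^^ k) f z) \<in> Lp p (weighted_volume \<alpha>)
        \<longleftrightarrow> weighted_class p (\<alpha> + p * real k) ((radial_deriv ^^ k) f)"
      by (rule Lp_iff)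
    also have "\<dots> \<longleftrightarrow> D k"
      unfolding D_def using that by (intro radial_funpow_in_class_iff[OF p _ f]) (simp add: mult.commute)
    finally show ?thesis .
  qed
  have a_iff: "f \<in> bergman_space p \<alpha> \<longleftrightarrow> (\<exists>k. real k * p + \<alpha> > -1 \<and> D k)"
    using f radial by (auto simp: bergman_space_def mult.commute)
  have indep_le: "D k \<longleftrightarrow> D l" if "k \<le> l" "real k * p + \<alpha> > -1" for k l
  proof -
    have "\<alpha> + p * real k > -1" using that(2) by (simp add: mult.commute add.commute)
    thus ?thesis unfolding D_def by (rule derivs_in_class_shift_order[OF p f that(1)])
  qed
  have indep: "D k \<longleftrightarrow> D l" if "real k * p + \<alpha> > -1" "real l * p + \<alpha> > -1" for k l
    using indep_le[of k l] indep_le[of l k] that by (metis nat_le_linear)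
  obtain k0 :: nat where k0: "real k0 * p + \<alpha> > -1"
  proof -
    obtain k :: nat where "- 1 - \<alpha> < real k * p"
      using reals_Archimedean3[OF p, rule_format, of "- 1 - \<alpha>"] by (elim exE)
    hence "real k * p + \<alpha> > - 1" by linarith
    thus thesis by (rule that)
  qed
  show ?thesis
    unfolding multi a_iff using indep k0 by blast
qed

end
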